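(* Let $W$, $X$, $Y$ and $Z$ be Banach lattices such that $X$ and $Y$ have order continuous norms and $Z$ is Dedekind complete. Then $$\|M_{A, B}\|_{r}=\|A\|_{r}\, \|B\|_r$$ for all $A\in L^{r}(Y, Z)$ and all $B\in L^{r}(W, X)$.
   Context: Banach lattices are real. For a Banach lattice $E$ and a Dedekind complete Banach lattice $F$, $L^{r}(E,F)$ denotes the set of all regular operators from $E$ into $F$ (differences of two positive linear operators); ordered by $S\le T$ iff $T-S$ is positive, it is a Dedekind complete Riesz space, and it is a Dedekind complete Banach lattice under the regular norm $\|S\|_r:=\|\,|S|\,\|$, where $|S|$ is the modulus of $S$ in $L^{r}(E,F)$ and $\|\cdot\|$ on the right is the operator norm. (A Banach lattice with order continuous norm is Dedekind complete.) For $A\in L^{r}(Y,Z)$ and $B\in L^{r}(W,X)$, the two-sided multiplication operator $M_{A,B}: L^{r}(X,Y)\to L^{r}(W,Z)$ is defined by $M_{A,B}(T)=ATB$. It is a regular operator between the Banach lattices $L^{r}(X,Y)$ and $L^{r}(W,Z)$ (each with its regular norm), and $\|M_{A,B}\|_r=\|\,|M_{A,B}|\,\|$ is its regular norm, with the modulus $|M_{A,B}|$ taken in $L^{r}\big(L^{r}(X, Y), L^{r}(W, Z)\big)$. *)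

theory Defs
  imports "HOL-Analysis.Analysis" "HOL-Library.Lattice_Algebras"
begin

section \<open>Banach lattices\<close>

class banach_lattice = banach + ordered_real_vector + lattice_ab_group_add_abs +
  assumes norm_lattice: "\<bar>x\<bar> \<le> \<bar>y\<bar> \<Longrightarrow> norm x \<le> norm y"

text \<open>
  Dedekind completeness is a mere property here. The class
  \<open>conditionally_complete_lattice\<close> would add the operations \<open>Sup\<close> and \<open>Inf\<close>
  to the structure.
\<close>

class dedekind_complete_banach_lattice = banach_lattice +
  assumes dedekind_complete:
    "A \<noteq> {} \<Longrightarrow> bdd_above A \<Longrightarrow>
      \<exists>s. (\<forall>a\<in>A. a \<le> s) \<and> (\<forall>u. (\<forall>a\<in>A. a \<le> u) \<longrightarrow> s \<le> u)"

text \<open>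
  Order continuity of the norm: a net decreasing to \<open>0\<close> converges to \<open>0\<close> in norm. The range of
  a decreasing net is a downward directed set \<open>D\<close>, and the net may be replaced by
  \<open>D\<close> indexed by itself, so that no quantification over index types is needed.
\<close>

class order_continuous_banach_lattice = banach_lattice +
  assumes order_continuous_norm:
    "\<lbrakk>D \<noteq> {}; \<And>x y. x \<in> D \<Longrightarrow> y \<in> D \<Longrightarrow> \<exists>z\<in>D. z \<le> x \<and> z \<le> y;
      \<And>x. x \<in> D \<Longrightarrow> 0 \<le> x; \<And>b. (\<And>x. x \<in> D \<Longrightarrow> b \<le> x) \<Longrightarrow> b \<le> 0; 0 < e\<rbrakk>
      \<Longrightarrow> \<exists>x\<in>D. \<forall>y\<in>D. y \<le> x \<longrightarrow> norm y < e"


section \<open>The ordered vector space of regular operators\<close>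

text \<open>
  Regular operators are introduced between ordered vector spaces with a generating positive cone
  (which is what makes the order below antisymmetric). This covers Banach lattices as well as
  the spaces of regular operators between them, so that operators between
  operator spaces are instances of the same type constructor.
\<close>

class generated_ordered_vector = ordered_real_vector +
  assumes positive_generating: "\<exists>p q. 0 \<le> p \<and> 0 \<le> q \<and> x = p - q"

subclass (in banach_lattice) generated_ordered_vector
proof
  fix x :: 'a
  have "x = pprt x - (- nprt x)"
    using prts[of x] by simp
  moreover have "0 \<le> pprt x" "0 \<le> - nprt x"
    by simp_all
  ultimately show "\<exists>p q. 0 \<le> p \<and> 0 \<le> q \<and> x = p - q"
    by blast
qed

definition positive_operator ::
    "('a::ordered_real_vector \<Rightarrow> 'b::ordered_real_vector) \<Rightarrow> bool" where
  "positive_operator P \<longleftrightarrow> linear P \<and> (\<forall>x\<ge>0. 0 \<le> P x)"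

definition regular_operator ::
    "('a::ordered_real_vector \<Rightarrow> 'b::ordered_real_vector) \<Rightarrow> bool" where
  "regular_operator T \<longleftrightarrow>
    (\<exists>P Q. positive_operator P \<and> positive_operator Q \<and> T = (\<lambda>x. P x - Q x))"

lemma positive_operator_zero: "positive_operator (\<lambda>x. 0)"
  by (simp add: positive_operator_def linear_zero)

lemma positive_operator_add:
  "positive_operator P \<Longrightarrow> positive_operator Q \<Longrightarrow> positive_operator (\<lambda>x. P x + Q x)"
  by (simp add: positive_operator_def linear_compose_add)

lemma positive_operator_scaleR:
  "positive_operator P \<Longrightarrow> 0 \<le> c \<Longrightarrow> positive_operator (\<lambda>x. c *\<^sub>R P x)"
  by (simp add: positive_operator_def linear_compose_scale_right scaleR_nonneg_nonneg)

lemma positive_operator_compose: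
  "positive_operator P \<Longrightarrow> positive_operator Q \<Longrightarrow> positive_operator (\<lambda>x. P (Q x))"
  using linear_compose[of Q P] by (simp add: positive_operator_def o_def)

lemma regular_operatorI:
  "positive_operator P \<Longrightarrow> positive_operator Q \<Longrightarrow> (\<And>x. T x = P x - Q x) \<Longrightarrow> regular_operator T"
  unfolding regular_operator_def by blast

lemma regular_operatorE:
  assumes "regular_operator T"
  obtains P Q where "positive_operator P" "positive_operator Q" "T = (\<lambda>x. P x - Q x)"
  using assms unfolding regular_operator_def by blast

lemma regular_operator_linear: "regular_operator T \<Longrightarrow> linear T"
  by (auto elim!: regular_operatorE simp: positive_operator_def linear_compose_sub)

lemma regular_operator_zero: "regular_operator (\<lambda>x. 0)"
  by (rule regular_operatorI[OF positive_operator_zero positive_operator_zero]) simp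

lemma regular_operator_uminus: "regular_operator T \<Longrightarrow> regular_operator (\<lambda>x. - T x)"
  by (elim regular_operatorE) (rule regular_operatorI, assumption, assumption, simp)

lemma regular_operator_add:
  assumes "regular_operator S" "regular_operator T"
  shows "regular_operator (\<lambda>x. S x + T x)"
proof -
  obtain P Q where S: "positive_operator P" "positive_operator Q" "S = (\<lambda>x. P x - Q x)"
    using assms(1) by (rule regular_operatorE)
  obtain P' Q' where T: "positive_operator P'" "positive_operator Q'" "T = (\<lambda>x. P' x - Q' x)"
    using assms(2) by (rule regular_operatorE)
  show ?thesis
    by (rule regular_operatorI[OF positive_operator_add[OF S(1) T(1)]
          positive_operator_add[OF S(2) T(2)]])
      (simp add: S(3) T(3))
qed

lemma regular_operator_scaleR:
  assumes "regular_operator T"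
  shows "regular_operator (\<lambda>x. c *\<^sub>R T x)"
proof -
  obtain P Q where T: "positive_operator P" "positive_operator Q" "T = (\<lambda>x. P x - Q x)"
    using assms by (rule regular_operatorE)
  have pos: "regular_operator (\<lambda>x. d *\<^sub>R T x)" if "0 \<le> d" for d
    by (rule regular_operatorI[OF positive_operator_scaleR[OF T(1) that]
          positive_operator_scaleR[OF T(2) that]])
      (simp add: T(3) scaleR_diff_right)
  show ?thesis
  proof (cases "0 \<le> c")
    case True
    then show ?thesis by (rule pos)
  next
    case False
    then show ?thesis
      using regular_operator_uminus[OF pos[of "- c"]] by simp
  qed
qed

lemma regular_operator_compose:
  assumes "regular_operator S" "regular_operator T"
  shows "regular_operator (\<lambda>x. S (T x))"
proof -
  obtain P Q where S: "positive_operator P" "positive_operator Q" "S = (\<lambda>x. P x - Q x)"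
    using assms(1) by (rule regular_operatorE)
  obtain P' Q' where T: "positive_operator P'" "positive_operator Q'" "T = (\<lambda>x. P' x - Q' x)"
    using assms(2) by (rule regular_operatorE)
  have lin: "linear P" "linear Q"
    using S by (simp_all add: positive_operator_def)
  note comp = positive_operator_compose
  show ?thesis
    by (rule regular_operatorI[OF
          positive_operator_add[OF comp[OF S(1) T(1)] comp[OF S(2) T(2)]]
          positive_operator_add[OF comp[OF S(1) T(2)] comp[OF S(2) T(1)]]])
      (simp add: S(3) T(3) linear_diff[OF lin(1)] linear_diff[OF lin(2)])
qed

typedef (overloaded) ('a::generated_ordered_vector, 'b::generated_ordered_vector) regop =
  "{T :: 'a \<Rightarrow> 'b. regular_operator T}"
  morphisms app Regop
  using regular_operator_zero by blast

setup_lifting type_definition_regop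

lemma regular_operator_app: "regular_operator (app T)"
  using app[of T] by simp

instantiation regop :: (generated_ordered_vector, generated_ordered_vector) real_vector
begin

lift_definition zero_regop :: "('a, 'b) regop" is "\<lambda>x. 0"
  by (rule regular_operator_zero)

lift_definition plus_regop :: "('a, 'b) regop \<Rightarrow> ('a, 'b) regop \<Rightarrow> ('a, 'b) regop"
  is "\<lambda>S T x. S x + T x"
  by (rule regular_operator_add)

lift_definition uminus_regop :: "('a, 'b) regop \<Rightarrow> ('a, 'b) regop" is "\<lambda>T x. - T x"
  by (rule regular_operator_uminus)

lift_definition minus_regop :: "('a, 'b) regop \<Rightarrow> ('a, 'b) regop \<Rightarrow> ('a, 'b) regop"
  is "\<lambda>S T x. S x - T x"
  using regular_operator_add[OF _ regular_operator_uminus] by fastforce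

lift_definition scaleR_regop :: "real \<Rightarrow> ('a, 'b) regop \<Rightarrow> ('a, 'b) regop"
  is "\<lambda>c T x. c *\<^sub>R T x"
  by (rule regular_operator_scaleR)

instance
  by standard (transfer; simp add: algebra_simps fun_eq_iff)+

end

instantiation regop :: (generated_ordered_vector, generated_ordered_vector) ordered_real_vector
begin

lift_definition less_eq_regop :: "('a, 'b) regop \<Rightarrow> ('a, 'b) regop \<Rightarrow> bool"
  is "\<lambda>S T. positive_operator (\<lambda>x. T x - S x)" .

definition less_regop :: "('a, 'b) regop \<Rightarrow> ('a, 'b) regop \<Rightarrow> bool" where
  "less_regop S T \<longleftrightarrow> S \<le> T \<and> \<not> T \<le> S"

lemma less_eq_regop_iff: "S \<le> T \<longleftrightarrow> (\<forall>x\<ge>0. app S x \<le> app T x)"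
  for S T :: "('a, 'b) regop"
  by transfer (auto simp: positive_operator_def intro: linear_compose_sub regular_operator_linear)

instance
proof
  fix S T U :: "('a, 'b) regop" and a b :: real
  show "S < T \<longleftrightarrow> S \<le> T \<and> \<not> T \<le> S"
    by (rule less_regop_def)
  show "S \<le> S"
    by (simp add: less_eq_regop_iff)
  show "S \<le> U" if "S \<le> T" "T \<le> U"
    using that by (auto simp: less_eq_regop_iff intro: order_trans)
  show "S = T" if "S \<le> T" "T \<le> S"
  proof -
    have eq: "app S x = app T x" if "0 \<le> x" for x
      using that \<open>S \<le> T\<close> \<open>T \<le> S\<close> by (simp add: less_eq_regop_iff order.antisym)
    have "app S x = app T x" for x
    proof -
      obtain p q where "0 \<le> p" "0 \<le> q" "x = p - q"
        using positive_generating[of x] by blast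
      then show ?thesis
        using eq[of p] eq[of q] linear_diff[OF regular_operator_linear[OF regular_operator_app]]
        by metis
    qed
    then show ?thesis
      by (simp add: app_inject[symmetric] fun_eq_iff)
  qed
  show "U + S \<le> U + T" if "S \<le> T"
    using that by (simp add: less_eq_regop_iff plus_regop.rep_eq)
  show "a *\<^sub>R S \<le> a *\<^sub>R T" if "S \<le> T" "0 \<le> a"
    using that by (simp add: less_eq_regop_iff scaleR_regop.rep_eq scaleR_left_mono)
  show "a *\<^sub>R S \<le> b *\<^sub>R S" if "a \<le> b" "0 \<le> S"
    using that by (simp add: less_eq_regop_iff scaleR_regop.rep_eq zero_regop.rep_eq scaleR_right_mono)
qed

end

instance regop :: (generated_ordered_vector, generated_ordered_vector) generated_ordered_vector
proof
  fix T :: "('a, 'b) regop"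
  obtain P Q where PQ: "positive_operator P" "positive_operator Q" "app T = (\<lambda>x. P x - Q x)"
    using regular_operator_app by (rule regular_operatorE)
  have reg: "regular_operator P" "regular_operator Q"
    using PQ(1,2) by (auto intro: regular_operatorI positive_operator_zero)
  have [simp]: "app (Regop P) = P" "app (Regop Q) = Q"
    using reg by (simp_all add: Regop_inverse)
  have "0 \<le> Regop P" "0 \<le> Regop Q"
    using PQ(1,2) by (simp_all add: less_eq_regop_iff zero_regop.rep_eq positive_operator_def)
  moreover have "T = Regop P - Regop Q"
    by (simp add: app_inject[symmetric] minus_regop.rep_eq PQ(3))
  ultimately show "\<exists>p q. 0 \<le> p \<and> 0 \<le> q \<and> T = p - q"
    by blast
qed


section \<open>Modulus and regular norm\<close>

text \<open>
  The modulus is the supremum of \<open>S\<close> and \<open>- S\<close> in the ordered space of regular operators. It exists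
  for all \<open>S\<close> whenever the codomain is Dedekind complete; otherwise it may be unspecified.
\<close>

instantiation regop :: (generated_ordered_vector, generated_ordered_vector) abs
begin

definition abs_regop :: "('a, 'b) regop \<Rightarrow> ('a, 'b) regop" where
  "\<bar>S :: ('a, 'b) regop\<bar> = (THE M. S \<le> M \<and> - S \<le> M \<and> (\<forall>N. S \<le> N \<and> - S \<le> N \<longrightarrow> M \<le> N))"

instance ..

end

lemma abs_regop_eqI:
  fixes S M :: "('a::generated_ordered_vector, 'b::generated_ordered_vector) regop"
  assumes "S \<le> M" "- S \<le> M" "\<And>N. S \<le> N \<Longrightarrow> - S \<le> N \<Longrightarrow> M \<le> N"
  shows "\<bar>S\<bar> = M"
  unfolding abs_regop_def using assms by (intro the_equality) (auto intro: order.antisym)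

text \<open>
  The norms of domain and codomain are explicit arguments, so that operators between spaces of
  regular operators, normed by the regular norm, are covered without
  presupposing that the regular norm is a norm. For normed spaces \<open>operator_norm\<close> is \<open>onorm\<close>.
\<close>

definition operator_norm :: "('a \<Rightarrow> real) \<Rightarrow> ('b \<Rightarrow> real) \<Rightarrow> ('a \<Rightarrow> 'b) \<Rightarrow> real" where
  "operator_norm N N' f = (SUP x. N' (f x) / N x)"

lemma operator_norm_eq_onorm: "operator_norm norm norm = onorm"
  by (simp add: operator_norm_def onorm_def fun_eq_iff)

definition regular_norm_wrt :: "('a \<Rightarrow> real) \<Rightarrow> ('b \<Rightarrow> real) \<Rightarrow>
    ('a::generated_ordered_vector, 'b::generated_ordered_vector) regop \<Rightarrow> real" where
  "regular_norm_wrt N N' S = operator_norm N N' (app \<bar>S\<bar>)"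

definition regular_norm :: "('a::banach_lattice, 'b::banach_lattice) regop \<Rightarrow> real" where
  "regular_norm = regular_norm_wrt norm norm"


section \<open>Two-sided multiplication operators\<close>

lift_definition compose_regop ::
  "('b::generated_ordered_vector, 'c::generated_ordered_vector) regop \<Rightarrow>
   ('a::generated_ordered_vector, 'b) regop \<Rightarrow> ('a, 'c) regop" (infixr "\<circ>\<^sub>r" 55)
  is "\<lambda>S T x. S (T x)"
  by (rule regular_operator_compose)

lemma positive_operator_two_sided:
  assumes "positive_operator (app A)" "positive_operator (app B)"
  shows "positive_operator (\<lambda>T. A \<circ>\<^sub>r T \<circ>\<^sub>r B)"
proof -
  have lin: "linear (app A)"
    using assms(1) by (simp add: positive_operator_def)
  have "linear (\<lambda>T. A \<circ>\<^sub>r T \<circ>\<^sub>r B)"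
    by (rule linearI)
      (simp_all add: app_inject[symmetric] fun_eq_iff compose_regop.rep_eq plus_regop.rep_eq
        scaleR_regop.rep_eq linear_add[OF lin] linear_scale[OF lin])
  then show ?thesis
    using assms
    by (simp add: positive_operator_def less_eq_regop_iff zero_regop.rep_eq compose_regop.rep_eq)
qed

lemma regular_operator_two_sided: "regular_operator (\<lambda>T. A \<circ>\<^sub>r T \<circ>\<^sub>r B)"
proof -
  obtain P Q where A: "0 \<le> P" "0 \<le> Q" "A = P - Q"
    using positive_generating by blast
  obtain P' Q' where B: "0 \<le> P'" "0 \<le> Q'" "B = P' - Q'"
    using positive_generating by blast
  have pos: "positive_operator (app S)" if "0 \<le> S"
    for S :: "('e::generated_ordered_vector, 'f::generated_ordered_vector) regop"
    using that by (simp add: less_eq_regop_iff zero_regop.rep_eq positive_operator_def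
        regular_operator_linear[OF regular_operator_app])
  note two = positive_operator_two_sided[OF pos pos]
  have lin: "linear (app S)"
    for S :: "('e::generated_ordered_vector, 'f::generated_ordered_vector) regop"
    by (rule regular_operator_linear[OF regular_operator_app])
  show ?thesis
    by (rule regular_operatorI[OF
          positive_operator_add[OF two[OF A(1) B(1)] two[OF A(2) B(2)]]
          positive_operator_add[OF two[OF A(1) B(2)] two[OF A(2) B(1)]]])
      (simp add: A(3) B(3) app_inject[symmetric] fun_eq_iff compose_regop.rep_eq
        plus_regop.rep_eq minus_regop.rep_eq linear_diff[OF lin])
qed

lift_definition two_sided_mult ::
  "('y::generated_ordered_vector, 'z::generated_ordered_vector) regop \<Rightarrow>
   ('w::generated_ordered_vector, 'x::generated_ordered_vector) regop \<Rightarrow>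
   (('x, 'y) regop, ('w, 'z) regop) regop"
  is "\<lambda>A B T. A \<circ>\<^sub>r T \<circ>\<^sub>r B"
  by (rule regular_operator_two_sided)

end

theory Submission
  imports Defs
begin

text \<open>
  The key is the identity \<open>\<bar>M\<^bsub>A,B\<^esub>\<bar> = M\<^bsub>\<bar>A\<bar>,\<bar>B\<bar>\<^esub>\<close>
  (\<open>abs_two_sided_mult\<close>). The operator on the right clearly dominates \<open>\<plusminus> M\<^bsub>A,B\<^esub>\<close>. Let
  \<open>N\<close> be another operator with \<open>\<plusminus> M\<^bsub>A,B\<^esub> \<le> N\<close>, and fix \<open>w \<ge> 0\<close>. Consider the set \<open>G\<close> of all
  \<open>g \<le> \<bar>B\<bar> w\<close> such that \<open>\<bar>A\<bar> S g \<le> N(S) w\<close> for every positive \<open>S\<close>. By the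
  Riesz-Kantorovich formula, \<open>\<bar>B\<bar> w\<close> is the supremum of the elements \<open>B v - B (w - v)\<close> with
  \<open>0 \<le> v \<le> w\<close>. These lie in \<open>G\<close>, and \<open>G\<close> is closed under binary suprema, so
  order continuity of the norm of \<open>X\<close> gives a sequence in \<open>G\<close> converging in norm to \<open>\<bar>B\<bar> w\<close>. Positive
  operators are bounded, whence \<open>\<bar>A\<bar> S \<bar>B\<bar> w \<le> N(S) w\<close>.

  Both facts about \<open>G\<close> come from cutting \<open>S\<close> into positive pieces \<open>P S Q\<close>, where \<open>P\<close> and \<open>Q\<close> are
  positive operators below the identity, and using additivity of \<open>N\<close>. The pieces must be
  adapted to given vectors: if \<open>0 \<le> v \<le> y\<^sup>+\<close>, there is an operator \<open>P\<close> with \<open>0 \<le> P \<le> I\<close> and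
  \<open>P y = v\<close> (\<open>splitting_of_identity\<close>). Indeed \<open>0 \<le> P \<le> I\<close> means \<open>P x \<le> x\<^sup>+\<close> for all \<open>x\<close>, so
  \<open>P\<close> is an extension of \<open>t y \<mapsto> t v\<close> dominated by a sublinear map, and the Hahn-Banach
  theorem holds for values in a Dedekind complete space. A Banach lattice with
  order continuous norm is such a space.

  It remains to compute the operator norm of \<open>T \<mapsto> \<bar>A\<bar> T \<bar>B\<bar>\<close>. It is at most
  \<open>\<parallel>A\<parallel>\<^sub>r \<parallel>B\<parallel>\<^sub>r\<close> because \<open>\<bar> \<bar>A\<bar> T \<bar>B\<bar> \<bar> \<le> \<bar>A\<bar> \<bar>T\<bar> \<bar>B\<bar>\<close>, and rank one operators
  \<open>x \<mapsto> f x y\<close> with a positive norming functional \<open>f\<close> show that it is at least that large.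
\<close>


section \<open>Banach lattices and positive operators\<close>

text \<open>
  The negative part of the limit is dominated by \<open>\<bar>f n - l\<bar>\<close>, which tends to \<open>0\<close> in norm.
\<close>

lemma positive_cone_closed:
  fixes f :: "nat \<Rightarrow> 'a::banach_lattice"
  assumes lim: "f \<longlonglongrightarrow> l" and pos: "\<And>n. 0 \<le> f n"
  shows "0 \<le> l"
proof -
  have "norm (pprt (- l)) \<le> norm (f n - l)" for n
  proof (rule norm_lattice)
    have "- l \<le> f n - l"
      using pos[of n] by simp
    also have "\<dots> \<le> \<bar>f n - l\<bar>"
      by (rule abs_ge_self)
    finally show "\<bar>pprt (- l)\<bar> \<le> \<bar>f n - l\<bar>"
      by (simp add: pprt_def)
  qed
  moreover have "(\<lambda>n. norm (f n - l)) \<longlonglongrightarrow> 0"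
    using lim by (simp add: LIM_zero tendsto_norm_zero)
  ultimately have "norm (pprt (- l)) \<le> 0"
    by (meson LIMSEQ_le_const)
  then have "pprt (- l) = 0"
    by simp
  then have "- l \<le> 0"
    by (simp only: le_zero_iff_zero_pprt)
  then show ?thesis
    by simp
qed

lemma LIMSEQ_le_banach_lattice:
  fixes f g :: "nat \<Rightarrow> 'a::banach_lattice"
  assumes "f \<longlonglongrightarrow> l" "g \<longlonglongrightarrow> m" "\<And>n. f n \<le> g n"
  shows "l \<le> m"
  using positive_cone_closed[OF tendsto_diff[OF assms(2,1)]] assms(3) by simp

lemma banach_lattice_archimedean:
  fixes b x :: "'a::banach_lattice"
  assumes "\<And>n::nat. real n *\<^sub>R b \<le> x"
  shows "b \<le> 0"
proof (rule LIMSEQ_le_banach_lattice)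
  show "b \<le> inverse (real (Suc n)) *\<^sub>R x" for n
    using scaleR_left_mono[OF assms[of "Suc n"], of "inverse (real (Suc n))"]
    by (simp del: of_nat_Suc)
  show "(\<lambda>n. inverse (real (Suc n)) *\<^sub>R x) \<longlonglongrightarrow> 0"
    using tendsto_scaleR[OF LIMSEQ_inverse_real_of_nat tendsto_const[of x]] by simp
qed (rule tendsto_const)

lemma norm_abs_banach_lattice: "norm \<bar>x\<bar> = norm x" for x :: "'a::banach_lattice"
  by (rule antisym; rule norm_lattice) simp_all

lemma norm_mono_banach_lattice: "0 \<le> x \<Longrightarrow> x \<le> y \<Longrightarrow> norm x \<le> norm y"
  for x y :: "'a::banach_lattice"
  by (rule norm_lattice) (simp add: order_trans[of 0 x y])

lemma positive_operator_mono:
  "positive_operator P \<Longrightarrow> x \<le> y \<Longrightarrow> P x \<le> P y"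
  unfolding positive_operator_def by (metis diff_ge_0_iff_ge linear_diff)

lemma abs_positive_operator_le:
  fixes P :: "'a::banach_lattice \<Rightarrow> 'b::banach_lattice"
  assumes "positive_operator P"
  shows "\<bar>P x\<bar> \<le> P \<bar>x\<bar>"
proof -
  have "- P x = P (- x)"
    using assms by (simp add: positive_operator_def linear_neg)
  then show ?thesis
    using positive_operator_mono[OF assms, of x "\<bar>x\<bar>"] positive_operator_mono[OF assms, of "- x" "\<bar>x\<bar>"]
    by (simp add: abs_lattice[of "P x"] abs_ge_self abs_ge_minus_self)
qed

text \<open>
  If \<open>P\<close> were unbounded, there would be positive \<open>z\<^sub>n\<close> of norm \<open>2\<^sup>-\<^sup>n\<close> with
  \<open>\<parallel>P z\<^sub>n\<parallel> > 2\<^sup>n\<close>. By completeness they have a sum \<open>s\<close>, and positivity forces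
  \<open>\<parallel>P z\<^sub>n\<parallel> \<le> \<parallel>P s\<parallel>\<close> for all \<open>n\<close>.
\<close>

lemma bounded_linear_positive_operator:
  fixes P :: "'a::banach_lattice \<Rightarrow> 'b::banach_lattice"
  assumes P: "positive_operator P"
  shows "bounded_linear P"
proof (rule ccontr)
  have lin: "linear P"
    using P by (simp add: positive_operator_def)
  assume "\<not> bounded_linear P"
  then have "\<exists>x. norm x * 4 ^ n < norm (P x)" for n :: nat
    using lin by (auto simp: bounded_linear_def bounded_linear_axioms_def not_le)
  then obtain x where x: "\<And>n. norm (x n) * 4 ^ n < norm (P (x n))"
    by metis
  have x0: "norm (x n) > 0" for n
    using x[of n] linear_0[OF lin] by (cases "x n = 0") auto
  define z where "z n = (inverse (norm (x n)) / 2 ^ n) *\<^sub>R \<bar>x n\<bar>" for n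
  have z_pos: "0 \<le> z n" for n
    unfolding z_def by (intro scaleR_nonneg_nonneg) auto
  have z_norm: "norm (z n) = (1/2) ^ n" for n
    using x0[of n] by (simp add: z_def norm_abs_banach_lattice power_one_over field_simps)
  have z_large: "2 ^ n < norm (P (z n))" for n
  proof -
    have "norm (P (x n)) \<le> norm (P \<bar>x n\<bar>)"
      using norm_lattice[of "P (x n)" "P \<bar>x n\<bar>"] abs_positive_operator_le[OF P, of "x n"]
      by (meson abs_ge_self order_trans)
    then have "norm (x n) * 4 ^ n < norm (P \<bar>x n\<bar>)"
      using x[of n] by simp
    moreover have "norm (P (z n)) = norm (P \<bar>x n\<bar>) / (norm (x n) * 2 ^ n)"
      using x0[of n] by (simp add: z_def linear_scale[OF lin] field_simps)
    moreover have "(4::real) ^ n = 2 ^ n * 2 ^ n"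
      by (simp add: power_mult_distrib[symmetric])
    ultimately have "(norm (x n) * 2 ^ n) * 2 ^ n < (norm (x n) * 2 ^ n) * norm (P (z n))"
      using x0[of n] by (simp add: mult.assoc)
    then show ?thesis
      using x0[of n] by simp
  qed
  have "summable z"
    by (rule summable_norm_cancel) (simp add: z_norm summable_geometric)
  then have lim: "(\<lambda>m. sum z {..<m + Suc n}) \<longlonglongrightarrow> suminf z" for n
    by (intro LIMSEQ_ignore_initial_segment summable_LIMSEQ)
  have "z n \<le> suminf z" for n
  proof (rule LIMSEQ_le_banach_lattice[OF tendsto_const lim[of n]])
    fix m
    show "z n \<le> sum z {..<m + Suc n}"
      using sum_mono2[of "{..<m + Suc n}" "{n}" z] z_pos by simp
  qed
  then have "P (z n) \<le> P (suminf z)" for n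
    by (rule positive_operator_mono[OF P])
  moreover have "0 \<le> P (z n)" for n
    using P z_pos by (simp add: positive_operator_def)
  ultimately have "norm (P (z n)) \<le> norm (P (suminf z))" for n
    by (intro norm_mono_banach_lattice)
  then have "2 ^ n < norm (P (suminf z))" for n :: nat
    using z_large by (meson order_less_le_trans)
  moreover obtain n :: nat where "norm (P (suminf z)) < 2 ^ n"
    using real_arch_pow[of 2] by auto
  ultimately show False
    by (meson less_asym)
qed


section \<open>Order continuous norms and Dedekind completeness\<close>

text \<open>
  Let \<open>U\<close> be the set of upper bounds of \<open>A\<close> and \<open>L\<close> the set of lower bounds of \<open>U\<close>. The
  differences \<open>u - l\<close> form a downward directed set. Any lower bound \<open>b\<close> of it satisfies
  \<open>L + b \<subseteq> L\<close>, hence \<open>b \<le> 0\<close> by the Archimedean property. So order continuity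
  provides \<open>u\<^sub>n - l\<^sub>n \<rightarrow> 0\<close> in norm; the sequence \<open>u\<^sub>n\<close> is then Cauchy and its limit,
  which is also the limit of \<open>l\<^sub>n\<close>, is the supremum of \<open>A\<close>.
\<close>

instance order_continuous_banach_lattice \<subseteq> dedekind_complete_banach_lattice
proof
  fix A :: "'a::order_continuous_banach_lattice set"
  assume A: "A \<noteq> {}" "bdd_above A"
  define U where "U = {u. \<forall>a\<in>A. a \<le> u}"
  define L where "L = {l. \<forall>u\<in>U. l \<le> u}"
  define D where "D = {u - l | u l. u \<in> U \<and> l \<in> L}"
  have AL: "a \<in> L" if "a \<in> A" for a
    using that by (auto simp: L_def U_def)
  have UL: "l \<le> u" if "u \<in> U" "l \<in> L" for u l
    using that by (auto simp: L_def)
  obtain u0 where u0: "u0 \<in> U"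
    using A(2) by (auto simp: U_def bdd_above_def)
  obtain l0 where l0: "l0 \<in> L"
    using A(1) AL by blast
  have ex: "\<exists>u l. u \<in> U \<and> l \<in> L \<and> norm (u - l) < e" if "0 < e" for e :: real
  proof -
    have "\<exists>x\<in>D. \<forall>y\<in>D. y \<le> x \<longrightarrow> norm y < e"
    proof (rule order_continuous_norm[OF _ _ _ _ that])
      show "D \<noteq> {}"
        using u0 l0 by (auto simp: D_def)
      show "0 \<le> x" if "x \<in> D" for x
        using that UL by (auto simp: D_def)
      show "\<exists>z\<in>D. z \<le> x \<and> z \<le> y" if xy: "x \<in> D" "y \<in> D" for x y
      proof -
        obtain u l u' l' where *: "x = u - l" "y = u' - l'" "u \<in> U" "l \<in> L" "u' \<in> U" "l' \<in> L"
          using xy by (auto simp: D_def)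
        have "inf u u' \<in> U" "sup l l' \<in> L"
          using * by (auto simp: U_def L_def)
        then have "inf u u' - sup l l' \<in> D"
          unfolding D_def by blast
        then show ?thesis
          by (rule bexI[rotated]) (auto simp: * simp del: diff_sup_eq_inf intro!: diff_mono)
      qed
      show "b \<le> 0" if "\<And>x. x \<in> D \<Longrightarrow> b \<le> x" for b
      proof (rule banach_lattice_archimedean)
        have b: "b \<le> u - l" if "u \<in> U" "l \<in> L" for u l
          using \<open>\<And>x. x \<in> D \<Longrightarrow> b \<le> x\<close> that by (auto simp: D_def)
        have step: "l + b \<in> L" if "l \<in> L" for l
          using b[OF _ that] by (auto simp: L_def algebra_simps)
        have "l0 + real n *\<^sub>R b \<in> L" for n
        proof (induction n)
          case (Suc n)
          then show ?case
            using step[of "l0 + real n *\<^sub>R b"] by (simp add: algebra_simps)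
        qed (simp add: l0)
        then show "real n *\<^sub>R b \<le> u0 - l0" for n
          using UL[OF u0] by (simp add: algebra_simps)
      qed
    qed
    then obtain x where "x \<in> D" "norm x < e"
      by blast
    then show ?thesis
      by (auto simp: D_def)
  qed
  have "\<exists>u l. u \<in> U \<and> l \<in> L \<and> norm (u - l) < inverse (real (Suc n))" for n
    by (rule ex) simp
  then obtain u l where u: "\<And>n. u n \<in> U" and l: "\<And>n. l n \<in> L"
    and ul: "\<And>n. norm (u n - l n) < inverse (real (Suc n))"
    by metis
  have ul0: "(\<lambda>n. u n - l n) \<longlonglongrightarrow> 0"
    by (rule Lim_null_comparison[OF _ LIMSEQ_inverse_real_of_nat])
      (auto intro!: always_eventually less_imp_le ul simp del: of_nat_Suc)
  have dist: "norm (u m - u n) \<le> norm (u m - l m) + norm (u n - l n)" for m n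
  proof -
    have "u m - u n \<le> u m - l m" "u n - u m \<le> u n - l n" "0 \<le> u m - l m" "0 \<le> u n - l n"
      using UL u l by (auto intro: diff_left_mono)
    then have "u m - u n \<le> (u m - l m) + (u n - l n)" "u n - u m \<le> (u m - l m) + (u n - l n)"
      by (metis add.commute add_increasing add_increasing2)+
    then have "\<bar>u m - u n\<bar> \<le> (u m - l m) + (u n - l n)"
      by (simp add: abs_le_iff)
    also have "\<dots> \<le> \<bar>(u m - l m) + (u n - l n)\<bar>"
      by (rule abs_ge_self)
    finally have "norm (u m - u n) \<le> norm ((u m - l m) + (u n - l n))"
      by (rule norm_lattice)
    also have "\<dots> \<le> norm (u m - l m) + norm (u n - l n)"
      by (rule norm_triangle_ineq)
    finally show ?thesis .
  qed
  have "Cauchy u"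
  proof (rule CauchyI)
    fix e :: real
    assume "0 < e"
    then have "0 < e / 2"
      by simp
    then obtain M where M: "\<And>n. M \<le> n \<Longrightarrow> norm (u n - l n) < e / 2"
      using LIMSEQ_D[OF ul0] by fastforce
    have "norm (u m - u n) < e" if "M \<le> m" "M \<le> n" for m n
      using dist[of m n] M[OF that(1)] M[OF that(2)] by simp
    then show "\<exists>M. \<forall>m\<ge>M. \<forall>n\<ge>M. norm (u m - u n) < e"
      by blast
  qed
  then obtain s where us: "u \<longlonglongrightarrow> s"
    using Cauchy_convergent convergent_def by blast
  then have ls: "l \<longlonglongrightarrow> s"
    using tendsto_diff[OF us ul0] by simp
  have "a \<le> s" if "a \<in> A" for a
    using u that by (intro LIMSEQ_le_banach_lattice[OF tendsto_const us]) (auto simp: U_def)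
  moreover have "s \<le> v" if "\<forall>a\<in>A. a \<le> v" for v
    using l that by (intro LIMSEQ_le_banach_lattice[OF ls tendsto_const]) (auto simp: U_def L_def)
  ultimately show "\<exists>s. (\<forall>a\<in>A. a \<le> s) \<and> (\<forall>u. (\<forall>a\<in>A. a \<le> u) \<longrightarrow> s \<le> u)"
    by blast
qed

instance real :: dedekind_complete_banach_lattice
proof
  fix A :: "real set"
  assume "A \<noteq> {}" "bdd_above A"
  then show "\<exists>s. (\<forall>a\<in>A. a \<le> s) \<and> (\<forall>u. (\<forall>a\<in>A. a \<le> u) \<longrightarrow> s \<le> u)"
    by (intro exI[of _ "Sup A"]) (auto intro: cSup_upper cSup_least)
qed simp

lemma dedekind_complete_Inf:
  fixes A :: "'a::dedekind_complete_banach_lattice set"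
  assumes "A \<noteq> {}" "\<And>a. a \<in> A \<Longrightarrow> m \<le> a"
  shows "\<exists>s. (\<forall>a\<in>A. s \<le> a) \<and> (\<forall>u. (\<forall>a\<in>A. u \<le> a) \<longrightarrow> u \<le> s)"
proof -
  have "bdd_above (uminus ` A)"
    using assms(2) by (intro bdd_aboveI2[of _ _ "- m"]) simp
  then obtain s where s: "\<forall>a\<in>A. - a \<le> s" "\<And>u. (\<forall>a\<in>A. - a \<le> u) \<Longrightarrow> s \<le> u"
    using dedekind_complete[of "uminus ` A"] assms(1) by auto
  have "- s \<le> a" if "a \<in> A" for a
    using s(1) that minus_le_iff by blast
  moreover have "u \<le> - s" if "\<forall>a\<in>A. u \<le> a" for u
    using s(2)[of "- u"] that le_minus_iff[of u s] by simp
  ultimately show ?thesis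
    by blast
qed


section \<open>Hahn-Banach-Kantorovich extension\<close>

text \<open>
  Requiring only \<open>p (c x) \<le> c p x\<close>, which implies equality, spares a second inequality
  when infima are shown to be sublinear. The case \<open>c = 0\<close> fixes \<open>p 0 = 0\<close>.
\<close>

definition sublinear :: "('e::real_vector \<Rightarrow> 'f::ordered_real_vector) \<Rightarrow> bool" where
  "sublinear p \<longleftrightarrow> (\<forall>x y. p (x + y) \<le> p x + p y) \<and> (\<forall>c\<ge>0. \<forall>x. p (c *\<^sub>R x) \<le> c *\<^sub>R p x)"

lemma sublinear_add: "sublinear p \<Longrightarrow> p (x + y) \<le> p x + p y"
  by (simp add: sublinear_def)

lemma sublinear_scaleR_le: "sublinear p \<Longrightarrow> 0 \<le> c \<Longrightarrow> p (c *\<^sub>R x) \<le> c *\<^sub>R p x"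
  by (simp add: sublinear_def)

lemma sublinear_zero:
  assumes "sublinear p"
  shows "p 0 = 0"
  using sublinear_add[OF assms, of 0 0] sublinear_scaleR_le[OF assms, of 0 0]
  by (simp add: order.antisym)

lemma sublinear_neg_le:
  assumes "sublinear p"
  shows "- p (- x) \<le> p x"
proof -
  have "0 \<le> p x + p (- x)"
    using sublinear_add[OF assms, of x "- x"] by (simp add: sublinear_zero[OF assms])
  then have "0 - p (- x) \<le> p x"
    by (simp only: diff_le_eq)
  then show ?thesis
    by simp
qed

lemma sublinear_scaleR:
  assumes p: "sublinear p" and c: "0 \<le> c"
  shows "p (c *\<^sub>R x) = c *\<^sub>R p x"
proof (cases "c = 0")
  case True
  then show ?thesis by (simp add: sublinear_zero[OF p])
next
  case False
  then have "c *\<^sub>R p (inverse c *\<^sub>R (c *\<^sub>R x)) \<le> c *\<^sub>R (inverse c *\<^sub>R p (c *\<^sub>R x))"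
    using c by (intro scaleR_left_mono sublinear_scaleR_le[OF p]) auto
  with False have "c *\<^sub>R p x \<le> p (c *\<^sub>R x)"
    by simp
  with sublinear_scaleR_le[OF p c] show ?thesis
    by (rule order.antisym)
qed

text \<open>
  The pointwise infimum of a family is sublinear as soon as the family
  dominates itself in the way that sublinearity of the infimum demands. Two families are of
  interest: chains of sublinear maps, and the translates of one sublinear map along a line.
\<close>

lemma sublinear_pointwise_infimum:
  fixes K :: "('e::real_vector \<Rightarrow> 'f::dedekind_complete_banach_lattice) set"
  assumes ne: "K \<noteq> {}"
    and bdd: "\<And>f x. f \<in> K \<Longrightarrow> m x \<le> f x"
    and add: "\<And>f g x y. f \<in> K \<Longrightarrow> g \<in> K \<Longrightarrow> \<exists>h\<in>K. h (x + y) \<le> f x + g y"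
    and scale: "\<And>f c x. f \<in> K \<Longrightarrow> 0 \<le> c \<Longrightarrow> \<exists>h\<in>K. h (c *\<^sub>R x) \<le> c *\<^sub>R f x"
  shows "\<exists>r. sublinear r \<and> (\<forall>f\<in>K. \<forall>x. r x \<le> f x)"
proof -
  have "\<exists>s. (\<forall>f\<in>K. s \<le> f x) \<and> (\<forall>u. (\<forall>f\<in>K. u \<le> f x) \<longrightarrow> u \<le> s)" for x
    using dedekind_complete_Inf[of "(\<lambda>f. f x) ` K" "m x"] ne bdd by auto
  then obtain r where r: "\<And>f x. f \<in> K \<Longrightarrow> r x \<le> f x"
    and great: "\<And>u x. (\<And>f. f \<in> K \<Longrightarrow> u \<le> f x) \<Longrightarrow> u \<le> r x"
    by metis
  have "r (x + y) \<le> r x + r y" for x y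
  proof -
    have le: "r (x + y) \<le> f x + g y" if "f \<in> K" "g \<in> K" for f g
      using add[OF that, of x y] r order_trans by blast
    have "r (x + y) - f x \<le> r y" if "f \<in> K" for f
      using le[OF that] by (intro great) (simp add: diff_le_eq add.commute)
    then have "r (x + y) - r y \<le> r x"
      by (intro great) (simp add: diff_le_eq add.commute)
    then show ?thesis
      by (simp add: diff_le_eq)
  qed
  moreover have "r (c *\<^sub>R x) \<le> c *\<^sub>R r x" if c: "0 \<le> c" for c x
  proof -
    have le: "r (c *\<^sub>R x) \<le> c *\<^sub>R f x" if "f \<in> K" for f
      using scale[OF that c, of x] r order_trans by blast
    show ?thesis
    proof (cases "c = 0")
      case True
      then show ?thesis
        using le ne by auto
    next
      case False
      have "inverse c *\<^sub>R r (c *\<^sub>R x) \<le> r x"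
      proof (rule great)
        fix f
        assume "f \<in> K"
        then show "inverse c *\<^sub>R r (c *\<^sub>R x) \<le> f x"
          using scaleR_left_mono[OF le[of f], of "inverse c"] c False by simp
      qed
      then show ?thesis
        using scaleR_left_mono[of "inverse c *\<^sub>R r (c *\<^sub>R x)" "r x" c] c False by simp
    qed
  qed
  ultimately show ?thesis
    using r unfolding sublinear_def by blast
qed

text \<open>
  The infimum over \<open>t\<close> of \<open>p (x + t y) - t v\<close> is the largest sublinear map below \<open>p\<close> that does not
  exceed the linear map \<open>t y \<mapsto> t v\<close> on the line through \<open>y\<close>.
\<close>

lemma sublinear_below_along_line:
  fixes p :: "'e::real_vector \<Rightarrow> 'f::dedekind_complete_banach_lattice"
  assumes p: "sublinear p" and v: "\<And>t::real. t *\<^sub>R v \<le> p (t *\<^sub>R y)"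
  obtains q where "sublinear q" "\<And>x. q x \<le> p x" "q y \<le> v" "q (- y) \<le> - v"
proof -
  define g where "g t x = p (x + t *\<^sub>R y) - t *\<^sub>R v" for t :: real and x
  have "\<exists>q. sublinear q \<and> (\<forall>f\<in>range g. \<forall>x. q x \<le> f x)"
  proof (rule sublinear_pointwise_infimum[of _ "\<lambda>x. - p (- x)"])
    fix f x
    assume "f \<in> range g"
    then obtain t where f: "f = g t" by blast
    have "t *\<^sub>R v \<le> p ((x + t *\<^sub>R y) + - x)"
      using v[of t] by simp
    also have "\<dots> \<le> p (x + t *\<^sub>R y) + p (- x)"
      by (rule sublinear_add[OF p])
    finally show "- p (- x) \<le> f x"
      by (simp add: f g_def algebra_simps)
  next
    fix f h x z
    assume "f \<in> range g" "h \<in> range g"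
    then obtain s t where f: "f = g s" and h: "h = g t" by blast
    have "g (s + t) (x + z) \<le> f x + h z"
      using sublinear_add[OF p, of "x + s *\<^sub>R y" "z + t *\<^sub>R y"]
      by (simp add: f h g_def algebra_simps)
    then show "\<exists>k\<in>range g. k (x + z) \<le> f x + h z"
      by blast
  next
    fix f and c :: real and x
    assume "f \<in> range g" "0 \<le> c"
    then obtain t where f: "f = g t" by blast
    have "g (c * t) (c *\<^sub>R x) \<le> c *\<^sub>R f x"
      using sublinear_scaleR_le[OF p \<open>0 \<le> c\<close>, of "x + t *\<^sub>R y"]
      by (simp add: f g_def algebra_simps)
    then show "\<exists>h\<in>range g. h (c *\<^sub>R x) \<le> c *\<^sub>R f x"
      by blast
  qed simp
  then obtain q where q: "sublinear q" "\<And>t x. q x \<le> p (x + t *\<^sub>R y) - t *\<^sub>R v"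
    by (auto simp: g_def)
  show thesis
  proof
    show "q x \<le> p x" for x
      using q(2)[of x 0] by simp
    show "q y \<le> v"
      using q(2)[of y "- 1"] by (simp add: sublinear_zero[OF p])
    show "q (- y) \<le> - v"
      using q(2)[of "- y" 1] by (simp add: sublinear_zero[OF p])
  qed (rule q(1))
qed

text \<open>
  Zorn's lemma for the reversed pointwise order. A chain of sublinear maps below \<open>p\<close> is bounded
  below at \<open>x\<close> by \<open>- p (- x)\<close>.
\<close>

lemma minimal_sublinear_below:
  fixes p :: "'e::real_vector \<Rightarrow> 'f::dedekind_complete_banach_lattice"
  assumes p: "sublinear p"
  obtains q where "sublinear q" "\<And>x. q x \<le> p x"
    "\<And>r. sublinear r \<Longrightarrow> (\<And>x. r x \<le> q x) \<Longrightarrow> r = q"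
proof -
  define S where "S = {q. sublinear q \<and> (\<forall>x. q x \<le> p x)}"
  define R where "R = (\<lambda>f g :: 'e \<Rightarrow> 'f. \<forall>x. g x \<le> f x)"
  have "\<exists>m\<in>S. \<forall>a\<in>S. R m a \<longrightarrow> a = m"
  proof (rule predicate_Zorn)
    show "partial_order_on S (relation_of R S)"
      by (rule partial_order_on_relation_ofI)
        (auto simp: R_def fun_eq_iff intro: order_trans order.antisym)
    fix C
    assume C: "C \<in> Chains (relation_of R S)"
    then have CS: "C \<subseteq> S"
      by (rule Chains_relation_of)
    show "\<exists>u\<in>S. \<forall>a\<in>C. R a u"
    proof (cases "C = {}")
      case True
      then show ?thesis
        using p by (auto simp: S_def)
    next
      case False
      have "\<exists>r. sublinear r \<and> (\<forall>f\<in>C. \<forall>x. r x \<le> f x)"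
      proof (rule sublinear_pointwise_infimum[OF False, of "\<lambda>x. - p (- x)"])
        fix f x
        assume "f \<in> C"
        then have f: "sublinear f" "f (- x) \<le> p (- x)"
          using CS by (auto simp: S_def)
        then show "- p (- x) \<le> f x"
          using sublinear_neg_le[OF f(1), of x] by (meson neg_le_iff_le order_trans)
      next
        fix f g x y
        assume fg: "f \<in> C" "g \<in> C"
        then have sub: "sublinear f" "sublinear g"
          using CS by (auto simp: S_def)
        have "R f g \<or> R g f"
          using C fg by (auto simp: Chains_def relation_of_def)
        then show "\<exists>h\<in>C. h (x + y) \<le> f x + g y"
        proof
          assume "R f g"
          then have "g (x + y) \<le> f x + g y"
            using sublinear_add[OF sub(2), of x y] unfolding R_def
            by (meson add_right_mono order_trans)
          then show ?thesis
            using fg by blast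
        next
          assume "R g f"
          then have "f (x + y) \<le> f x + g y"
            using sublinear_add[OF sub(1), of x y] unfolding R_def
            by (meson add_left_mono order_trans)
          then show ?thesis
            using fg by blast
        qed
      next
        fix f and c :: real and x
        assume "f \<in> C" "0 \<le> c"
        then show "\<exists>h\<in>C. h (c *\<^sub>R x) \<le> c *\<^sub>R f x"
          using CS by (intro bexI[of _ f]) (auto simp: S_def sublinear_def)
      qed
      then obtain r where r: "sublinear r" "\<And>f x. f \<in> C \<Longrightarrow> r x \<le> f x"
        by blast
      obtain f where f: "f \<in> C"
        using False by blast
      have "r x \<le> p x" for x
        using r(2)[OF f, of x] CS f by (auto simp: S_def intro: order_trans)
      then have "r \<in> S"
        using r(1) by (simp add: S_def)
      then show ?thesis
        using r(2) by (auto simp: R_def)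
    qed
  qed
  then obtain q where q: "q \<in> S" "\<And>a. a \<in> S \<Longrightarrow> R q a \<Longrightarrow> a = q"
    by blast
  show thesis
  proof
    show "sublinear q" "q x \<le> p x" for x
      using q(1) by (auto simp: S_def)
    show "r = q" if "sublinear r" "\<And>x. r x \<le> q x" for r
    proof (rule q(2))
      show "r \<in> S"
        using that q(1) by (auto simp: S_def intro: order_trans)
      show "R q r"
        using that by (simp add: R_def)
    qed
  qed
qed

text \<open>
  A minimal sublinear map \<open>q\<close> is linear: pushing it down along the line through \<open>y\<close> with \<open>v = q y\<close>
  does not change it, so that \<open>q (- y) \<le> - q y\<close>. Pushing \<open>p\<close> down along the line through \<open>y\<close>
  before minimizing prescribes the value at \<open>y\<close>.
\<close>

theorem hahn_banach_kantorovich: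
  fixes p :: "'e::real_vector \<Rightarrow> 'f::dedekind_complete_banach_lattice"
  assumes p: "sublinear p" and v: "\<And>t::real. t *\<^sub>R v \<le> p (t *\<^sub>R y)"
  obtains f where "linear f" "\<And>x. f x \<le> p x" "f y = v"
proof -
  obtain p' where p': "sublinear p'" "\<And>x. p' x \<le> p x" "p' y \<le> v" "p' (- y) \<le> - v"
    using sublinear_below_along_line[OF p v] by metis
  obtain q where q: "sublinear q" "\<And>x. q x \<le> p' x"
    and minimal: "\<And>r. sublinear r \<Longrightarrow> (\<And>x. r x \<le> q x) \<Longrightarrow> r = q"
    using minimal_sublinear_below[OF p'(1)] by metis
  have neg: "q (- x) = - q x" for x
  proof -
    have "t *\<^sub>R q x \<le> q (t *\<^sub>R x)" for t :: real
    proof (cases "0 \<le> t")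
      case True
      then show ?thesis
        by (simp add: sublinear_scaleR[OF q(1)])
    next
      case False
      then have "q ((- t) *\<^sub>R x) = (- t) *\<^sub>R q x"
        by (intro sublinear_scaleR[OF q(1)]) simp
      then show ?thesis
        using sublinear_neg_le[OF q(1), of "t *\<^sub>R x"] by simp
    qed
    then obtain r where r: "sublinear r" "\<And>z. r z \<le> q z" "r (- x) \<le> - q x"
      using sublinear_below_along_line[OF q(1)] by metis
    then have "q (- x) \<le> - q x"
      using minimal by blast
    moreover have "- q x \<le> q (- x)"
      using sublinear_neg_le[OF q(1), of "- x"] by simp
    ultimately show ?thesis
      by (rule order.antisym)
  qed
  show thesis
  proof
    show "linear q"
    proof (rule linearI)
      show "q (x + z) = q x + q z" for x z
      proof (rule order.antisym)
        have "q ((x + z) + - z) \<le> q (x + z) + q (- z)"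
          by (rule sublinear_add[OF q(1)])
        then show "q x + q z \<le> q (x + z)"
          by (simp add: neg algebra_simps)
      qed (rule sublinear_add[OF q(1)])
      show "q (c *\<^sub>R x) = c *\<^sub>R q x" for c x
      proof (cases "0 \<le> c")
        case False
        then have "q ((- c) *\<^sub>R x) = (- c) *\<^sub>R q x"
          by (intro sublinear_scaleR[OF q(1)]) simp
        then show ?thesis
          by (simp add: neg)
      qed (rule sublinear_scaleR[OF q(1)])
    qed
    show "q x \<le> p x" for x
      using q(2) p'(2) order_trans by blast
    have "q y \<le> v"
      using q(2) p'(3) order_trans by blast
    moreover have "v \<le> q y"
      using order_trans[OF q(2) p'(4)] by (simp add: neg)
    ultimately show "q y = v"
      by (rule order.antisym)
  qed
qed

lemma pprt_add_le: "pprt (x + y) \<le> pprt x + pprt y" for x y :: "'a::lattice_ab_group_add"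
proof -
  have "x + y \<le> pprt x + pprt y"
    by (rule add_mono) (simp_all add: pprt_def)
  then show ?thesis
    by (simp add: pprt_def[of "x + y"])
qed

lemma pprt_scaleR_le: "0 \<le> c \<Longrightarrow> pprt (c *\<^sub>R x) \<le> c *\<^sub>R pprt x"
  for x :: "'a::banach_lattice"
  by (simp add: pprt_def[of "c *\<^sub>R x"] scaleR_nonneg_nonneg scaleR_left_mono pprt_def)

lemma sublinear_pprt: "sublinear (pprt :: 'a::banach_lattice \<Rightarrow> 'a)"
  by (simp add: sublinear_def pprt_add_le pprt_scaleR_le)

lemma positive_operator_app: "0 \<le> S \<Longrightarrow> positive_operator (app S)"
  by (simp add: less_eq_regop_iff zero_regop.rep_eq positive_operator_def
      regular_operator_linear[OF regular_operator_app])

lemma linear_app: "linear (app S)"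
  by (rule regular_operator_linear[OF regular_operator_app])

lemma positive_operator_regopE:
  assumes "positive_operator P"
  obtains S where "0 \<le> S" "app S = P"
proof
  have "regular_operator P"
    using regular_operatorI[OF assms positive_operator_zero] by simp
  then show *: "app (Regop P) = P"
    by (simp add: Regop_inverse)
  show "0 \<le> Regop P"
    using assms by (simp add: less_eq_regop_iff zero_regop.rep_eq * positive_operator_def)
qed

text \<open>
  The operator \<open>P\<close> extends \<open>t y \<mapsto> t v\<close> below \<open>x \<mapsto> x\<^sup>+\<close>: this bound says that
  \<open>P\<close> lies between \<open>0\<close> and the identity. Multiplication by a function with values in
  \<open>[0, 1]\<close> is the model case. The uses are \<open>0 \<le> v \<le> y\<close>, where \<open>P\<close> and \<open>Q\<close> split \<open>y\<close> into \<open>v\<close> and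
  \<open>y - v\<close>, and \<open>v = y\<^sup>+\<close>, where they separate the positive from the negative part of \<open>y\<close>.
\<close>

lemma splitting_of_identity:
  fixes y v :: "'a::dedekind_complete_banach_lattice"
  assumes v: "0 \<le> v" "v \<le> pprt y"
  obtains P Q :: "('a, 'a) regop"
  where "0 \<le> P" "0 \<le> Q" "\<And>x. app P x + app Q x = x" "app P y = v"
proof -
  have line: "t *\<^sub>R v \<le> pprt (t *\<^sub>R y)" for t :: real
  proof (cases "0 \<le> t")
    case True
    then show ?thesis
      using v(2) by (simp add: sublinear_scaleR[OF sublinear_pprt] scaleR_left_mono)
  next
    case False
    then have "t *\<^sub>R v \<le> 0"
      using v(1) by (simp add: scaleR_nonpos_nonneg)
    then show ?thesis
      by (rule order_trans) simp
  qed
  obtain f where f: "linear f" "\<And>x. f x \<le> pprt x" "f y = v"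
    using hahn_banach_kantorovich[OF sublinear_pprt line] by metis
  have "0 \<le> f x" if "0 \<le> x" for x
    using f(2)[of "- x"] that by (simp add: linear_neg[OF f(1)])
  then have "positive_operator f"
    using f(1) by (simp add: positive_operator_def)
  moreover have "f x \<le> x" if "0 \<le> x" for x
    using f(2)[of x] that by simp
  then have "positive_operator (\<lambda>x. x - f x)"
    using f(1) by (simp add: positive_operator_def linear_compose_sub linear_ident)
  ultimately obtain P Q :: "('a, 'a) regop"
    where "0 \<le> P" "app P = f" "0 \<le> Q" "app Q = (\<lambda>x. x - f x)"
    by (metis positive_operator_regopE)
  then show thesis
    using f(3) by (intro that[of P Q]) auto
qed

text \<open>
  The bound \<open>x \<mapsto> \<parallel>x\<^sup>+\<parallel>\<close> makes the extension of \<open>t y \<mapsto> t \<parallel>y\<parallel>\<close> positive as well as contractive.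
\<close>

lemma positive_norming_functional:
  fixes y :: "'a::banach_lattice"
  assumes y: "0 \<le> y"
  obtains f :: "'a \<Rightarrow> real"
  where "linear f" "\<And>x. 0 \<le> x \<Longrightarrow> 0 \<le> f x" "\<And>x. \<bar>f x\<bar> \<le> norm x" "f y = norm y"
proof -
  have "sublinear (\<lambda>x::'a. norm (pprt x))"
    unfolding sublinear_def
  proof (intro conjI allI impI)
    show "norm (pprt (x + z)) \<le> norm (pprt x) + norm (pprt z)" for x z :: 'a
      by (rule order_trans[OF norm_mono_banach_lattice[OF zero_le_pprt pprt_add_le] norm_triangle_ineq])
    show "norm (pprt (c *\<^sub>R x)) \<le> c *\<^sub>R norm (pprt x)" if "0 \<le> c" for c and x :: 'a
      using sublinear_scaleR[OF sublinear_pprt that, of x] that by simp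
  qed
  moreover have "t *\<^sub>R norm y \<le> norm (pprt (t *\<^sub>R y))" for t :: real
  proof (cases "0 \<le> t")
    case True
    then show ?thesis
      using y by (simp add: sublinear_scaleR[OF sublinear_pprt])
  next
    case False
    then show ?thesis
      by (simp add: mult_nonpos_nonneg order_trans[OF _ norm_ge_zero])
  qed
  ultimately obtain f where f: "linear f" "\<And>x. f x \<le> norm (pprt x)" "f y = norm y"
    by (metis hahn_banach_kantorovich)
  have norm_pprt: "norm (pprt x) \<le> norm x" for x :: 'a
    by (rule norm_lattice) (simp add: pprt_def abs_ge_self)
  show thesis
  proof
    show "0 \<le> f x" if "0 \<le> x" for x
      using f(2)[of "- x"] that by (simp add: linear_neg[OF f(1)])
    show "\<bar>f x\<bar> \<le> norm x" for x
      using order_trans[OF f(2) norm_pprt, of x] order_trans[OF f(2) norm_pprt, of "- x"]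
      by (simp add: linear_neg[OF f(1)])
  qed (use f in auto)
qed


section \<open>The modulus of a regular operator\<close>

lemma additive_on_cone_extension:
  fixes r :: "'a::banach_lattice \<Rightarrow> 'b::ordered_real_vector"
  assumes add: "\<And>x y. 0 \<le> x \<Longrightarrow> 0 \<le> y \<Longrightarrow> r (x + y) = r x + r y"
    and scale: "\<And>c x. 0 \<le> c \<Longrightarrow> 0 \<le> x \<Longrightarrow> r (c *\<^sub>R x) = c *\<^sub>R r x"
    and pos: "\<And>x. 0 \<le> x \<Longrightarrow> 0 \<le> r x"
  obtains R where "positive_operator R" "\<And>x. 0 \<le> x \<Longrightarrow> R x = r x"
proof -
  define R where "R x = r (pprt x) - r (- nprt x)" for x
  have R_diff: "R (a - b) = r a - r b" if "0 \<le> a" "0 \<le> b" for a b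
  proof -
    have "pprt (a - b) + b = a + - nprt (a - b)"
      using prts[of "a - b"] by (simp add: algebra_simps)
    then have "r (pprt (a - b) + b) = r (a + - nprt (a - b))"
      by simp
    then have "r (pprt (a - b)) + r b = r a + r (- nprt (a - b))"
      using that by (simp only: add zero_le_pprt neg_0_le_iff_le nprt_le_zero)
    then show ?thesis
      by (simp add: R_def algebra_simps)
  qed
  have parts: "x = pprt x - - nprt x" "0 \<le> pprt x" "0 \<le> - nprt x" for x :: 'a
    using prts[of x] by simp_all
  show thesis
  proof
    show eq: "R x = r x" if "0 \<le> x" for x
      using R_diff[OF that order_refl] add[of 0 0] by simp
    have "linear R"
    proof (rule linearI)
      fix x y :: 'a
      have "(pprt x + pprt y) - (- nprt x + - nprt y) = (pprt x + nprt x) + (pprt y + nprt y)"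
        by simp
      then have "x + y = (pprt x + pprt y) - (- nprt x + - nprt y)"
        by (simp only: prts[symmetric])
      then have "R (x + y) = r (pprt x + pprt y) - r (- nprt x + - nprt y)"
        using parts(2,3) by (metis R_diff add_nonneg_nonneg)
      also have "\<dots> = R x + R y"
        unfolding R_def add[OF parts(2)[of x] parts(2)[of y]] add[OF parts(3)[of x] parts(3)[of y]]
        by simp
      finally show "R (x + y) = R x + R y" .
    next
      fix c and x :: 'a
      show "R (c *\<^sub>R x) = c *\<^sub>R R x"
      proof (cases "0 \<le> c")
        case True
        have "c *\<^sub>R x = c *\<^sub>R pprt x - c *\<^sub>R - nprt x"
          using parts(1)[of x] by (metis scaleR_diff_right)
        then have "R (c *\<^sub>R x) = r (c *\<^sub>R pprt x) - r (c *\<^sub>R - nprt x)"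
          using parts(2,3) True by (metis R_diff scaleR_nonneg_nonneg)
        also have "\<dots> = c *\<^sub>R R x"
          using parts(2,3)[of x] True by (simp only: scale R_def scaleR_diff_right)
        finally show ?thesis .
      next
        case False
        then have c: "0 \<le> - c"
          by simp
        have "c *\<^sub>R x = (- c) *\<^sub>R - nprt x - (- c) *\<^sub>R pprt x"
          using arg_cong[OF parts(1)[of x], of "scaleR c"] by (simp add: algebra_simps)
        then have "R (c *\<^sub>R x) = r ((- c) *\<^sub>R - nprt x) - r ((- c) *\<^sub>R pprt x)"
          using parts(2,3) c by (metis R_diff scaleR_nonneg_nonneg)
        also have "\<dots> = (- c) *\<^sub>R r (- nprt x) - (- c) *\<^sub>R r (pprt x)"
          using parts(2,3)[of x] c by (simp only: scale)
        also have "\<dots> = c *\<^sub>R R x"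
          by (simp add: R_def algebra_simps)
        finally show ?thesis .
      qed
    qed
    then show "positive_operator R"
      by (simp add: positive_operator_def eq pos)
  qed
qed

text \<open>
  The positive part of \<open>T\<close> at \<open>w\<close> is the supremum of \<open>T v\<close> over \<open>0 \<le> v \<le> w\<close>. It is
  additive in \<open>w\<close> because \<open>v \<le> w\<^sub>1 + w\<^sub>2\<close> splits as \<open>inf v w\<^sub>1\<close> and \<open>v - inf v w\<^sub>1 \<le> w\<^sub>2\<close>.
\<close>

lemma riesz_kantorovich_positive_part:
  fixes T :: "('a::banach_lattice, 'b::dedekind_complete_banach_lattice) regop"
  obtains R :: "('a, 'b) regop" where "0 \<le> R" "T \<le> R"
    "\<And>w z. 0 \<le> w \<Longrightarrow> (\<And>v. 0 \<le> v \<Longrightarrow> v \<le> w \<Longrightarrow> app T v \<le> z) \<Longrightarrow> app R w \<le> z"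
proof -
  obtain P Q where PQ: "0 \<le> P" "0 \<le> Q" "T = P - Q"
    using positive_generating[of T] by blast
  have TP: "app T v \<le> app P w" if "0 \<le> v" "v \<le> w" for v w
  proof -
    have "app T v \<le> app P v"
      using PQ(2) that(1) by (simp add: PQ(3) minus_regop.rep_eq less_eq_regop_iff zero_regop.rep_eq)
    also have "\<dots> \<le> app P w"
      by (rule positive_operator_mono[OF positive_operator_app[OF PQ(1)] that(2)])
    finally show ?thesis .
  qed
  have "\<exists>s. (\<forall>v. 0 \<le> v \<and> v \<le> w \<longrightarrow> app T v \<le> s)
      \<and> (\<forall>z. (\<forall>v. 0 \<le> v \<and> v \<le> w \<longrightarrow> app T v \<le> z) \<longrightarrow> s \<le> z)" if "0 \<le> w" for w
  proof -
    have "app T ` {0..w} \<noteq> {}" "bdd_above (app T ` {0..w})"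
      using that TP by (auto intro: bdd_aboveI2[of _ _ "app P w"])
    from dedekind_complete[OF this] obtain s where "\<forall>a\<in>app T ` {0..w}. a \<le> s"
      and "\<forall>z. (\<forall>a\<in>app T ` {0..w}. a \<le> z) \<longrightarrow> s \<le> z"
      by (elim exE conjE)
    then show ?thesis
      by (intro exI[of _ s]) simp
  qed
  then obtain r where r: "\<And>w. 0 \<le> w \<Longrightarrow> (\<forall>v. 0 \<le> v \<and> v \<le> w \<longrightarrow> app T v \<le> r w)
      \<and> (\<forall>z. (\<forall>v. 0 \<le> v \<and> v \<le> w \<longrightarrow> app T v \<le> z) \<longrightarrow> r w \<le> z)"
    by metis
  have upper: "app T v \<le> r w" if "0 \<le> v" "v \<le> w" for v w
    using r[OF order_trans[OF that]] that by blast
  have least: "r w \<le> z" if "0 \<le> w" "\<And>v. 0 \<le> v \<Longrightarrow> v \<le> w \<Longrightarrow> app T v \<le> z" for w z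
    using r[OF that(1)] that(2) by blast
  have add: "r (x + y) = r x + r y" if "0 \<le> x" "0 \<le> y" for x y
  proof (rule order.antisym)
    show "r (x + y) \<le> r x + r y"
    proof (rule least)
      fix v
      assume v: "0 \<le> v" "v \<le> x + y"
      have "v - y \<le> inf v x"
        using v that by (simp add: diff_le_eq)
      then have "v - inf v x \<le> y"
        by (simp only: diff_le_eq add.commute)
      moreover have "0 \<le> v - inf v x"
        by (simp only: diff_ge_0_iff_ge inf_le1)
      ultimately have "app T (inf v x) + app T (v - inf v x) \<le> r x + r y"
        using v(1) that(1) by (intro add_mono upper) simp_all
      then show "app T v \<le> r x + r y"
        by (simp only: linear_add[OF linear_app, symmetric] add_diff_eq add_diff_cancel_left')
    qed (use that in simp)
    have "app T u + app T v \<le> r (x + y)" if "0 \<le> u" "u \<le> x" "0 \<le> v" "v \<le> y" for u v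
      using upper[of "u + v" "x + y"] that by (simp add: linear_add[OF linear_app] add_mono)
    then have "r x \<le> r (x + y) - app T v" if "0 \<le> v" "v \<le> y" for v
      using that \<open>0 \<le> x\<close> by (intro least) (auto simp: le_diff_eq)
    then have "r y \<le> r (x + y) - r x"
      using \<open>0 \<le> y\<close> by (intro least) (auto simp: le_diff_eq add.commute)
    then show "r x + r y \<le> r (x + y)"
      by (simp add: le_diff_eq add.commute)
  qed
  have pos: "0 \<le> r x" if "0 \<le> x" for x
    using upper[OF order_refl that] by (simp add: linear_0[OF linear_app])
  have scale_le: "r (c *\<^sub>R x) \<le> c *\<^sub>R r x" if "0 < c" "0 \<le> x" for c x
  proof (rule least)
    fix v
    assume v: "0 \<le> v" "v \<le> c *\<^sub>R x"
    then have "inverse c *\<^sub>R v \<le> x"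
      using scaleR_left_mono[of v "c *\<^sub>R x" "inverse c"] that by simp
    then have "app T (inverse c *\<^sub>R v) \<le> r x"
      using v that by (intro upper) (auto intro: scaleR_nonneg_nonneg)
    then have "c *\<^sub>R app T (inverse c *\<^sub>R v) \<le> c *\<^sub>R r x"
      using that by (intro scaleR_left_mono) auto
    then show "app T v \<le> c *\<^sub>R r x"
      using that by (simp add: linear_scale[OF linear_app])
  qed (use that in \<open>auto intro: scaleR_nonneg_nonneg\<close>)
  have scale: "r (c *\<^sub>R x) = c *\<^sub>R r x" if "0 \<le> c" "0 \<le> x" for c x
  proof (cases "c = 0")
    case True
    then show ?thesis
      using add[of 0 0] by simp
  next
    case False
    with that have c: "0 < c" by simp
    have "r (inverse c *\<^sub>R c *\<^sub>R x) \<le> inverse c *\<^sub>R r (c *\<^sub>R x)"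
      using c that by (intro scale_le) (auto intro: scaleR_nonneg_nonneg)
    then have "c *\<^sub>R r x \<le> r (c *\<^sub>R x)"
      using scaleR_left_mono[of "r x" "inverse c *\<^sub>R r (c *\<^sub>R x)" c] c by simp
    then show ?thesis
      using scale_le[OF c that(2)] by (simp add: order.antisym)
  qed
  obtain R where R: "positive_operator R" "\<And>x. 0 \<le> x \<Longrightarrow> R x = r x"
    using additive_on_cone_extension[OF add scale pos] by blast
  obtain R' :: "('a, 'b) regop" where R': "0 \<le> R'" "app R' = R"
    using positive_operator_regopE[OF R(1)] by blast
  show thesis
    by (rule that[of R'])
      (auto simp: R' R(2) less_eq_regop_iff[of T] intro: upper least)
qed

text \<open>
  The values \<open>T v - T (w - v)\<close> are those of \<open>T\<close> at the points \<open>u\<close> with \<open>- w \<le> u \<le> w\<close>, written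
  as \<open>u = v - (w - v)\<close>. Every operator dominating \<open>\<plusminus> T\<close> bounds them.
\<close>

lemma app_swing_le:
  fixes T N :: "('a::generated_ordered_vector, 'b::generated_ordered_vector) regop"
  assumes "T \<le> N" "- T \<le> N" "0 \<le> v" "v \<le> w"
  shows "app T v - app T (w - v) \<le> app N w"
proof -
  have "app T v \<le> app N v" "- app T (w - v) \<le> app N (w - v)"
    using assms by (auto simp: less_eq_regop_iff uminus_regop.rep_eq)
  then have "app T v + - app T (w - v) \<le> app N v + app N (w - v)"
    by (rule add_mono)
  also have "\<dots> = app N w"
    by (simp add: linear_add[OF linear_app, symmetric])
  finally show ?thesis
    by simp
qed

text \<open>
  The modulus is \<open>2 T\<^sup>+ - T\<close>, so its value at \<open>w\<close> is the supremum of
  \<open>2 T v - T w = T v - T (w - v)\<close> over \<open>0 \<le> v \<le> w\<close>.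
\<close>

lemma riesz_kantorovich:
  fixes T :: "('a::banach_lattice, 'b::dedekind_complete_banach_lattice) regop"
  shows abs_regop_ge_self: "T \<le> \<bar>T\<bar>"
    and abs_regop_ge_minus_self: "- T \<le> \<bar>T\<bar>"
    and app_abs_regop_least: "0 \<le> w \<Longrightarrow>
      (\<And>v. 0 \<le> v \<Longrightarrow> v \<le> w \<Longrightarrow> app T v - app T (w - v) \<le> z) \<Longrightarrow> app \<bar>T\<bar> w \<le> z"
proof -
  obtain R :: "('a, 'b) regop" where R: "0 \<le> R" "T \<le> R"
    and R_least: "\<And>w z. 0 \<le> w \<Longrightarrow> (\<And>v. 0 \<le> v \<Longrightarrow> v \<le> w \<Longrightarrow> app T v \<le> z) \<Longrightarrow> app R w \<le> z"
    using riesz_kantorovich_positive_part[of T] by metis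
  have le: "T \<le> R + R - T" "- T \<le> R + R - T"
    using add_mono[OF R(2) R(2)] add_mono[OF R(1) R(1)] by (simp_all add: algebra_simps)
  have least: "app (R + R - T) w \<le> z"
    if w: "0 \<le> w" and z: "\<And>v. 0 \<le> v \<Longrightarrow> v \<le> w \<Longrightarrow> app T v - app T (w - v) \<le> z" for w z
  proof -
    have "app R w \<le> (1/2) *\<^sub>R (z + app T w)"
    proof (rule R_least[OF w])
      fix v
      assume "0 \<le> v" "v \<le> w"
      then have "2 *\<^sub>R app T v \<le> z + app T w"
        using z[of v] by (simp add: linear_diff[OF linear_app] algebra_simps scaleR_2)
      then show "app T v \<le> (1/2) *\<^sub>R (z + app T w)"
        using scaleR_left_mono[of "2 *\<^sub>R app T v" "z + app T w" "1/2"] by simp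
    qed
    then have "2 *\<^sub>R app R w \<le> z + app T w"
      using scaleR_left_mono[of "app R w" "(1/2) *\<^sub>R (z + app T w)" 2] by simp
    then show ?thesis
      by (simp add: plus_regop.rep_eq minus_regop.rep_eq scaleR_2 algebra_simps)
  qed
  have eq: "\<bar>T\<bar> = R + R - T"
  proof (rule abs_regop_eqI[OF le])
    fix N
    assume N: "T \<le> N" "- T \<le> N"
    show "R + R - T \<le> N"
      using least app_swing_le[OF N] by (simp add: less_eq_regop_iff)
  qed
  show "T \<le> \<bar>T\<bar>" "- T \<le> \<bar>T\<bar>"
    using le by (simp_all add: eq)
  show "app \<bar>T\<bar> w \<le> z"
    if "0 \<le> w" "\<And>v. 0 \<le> v \<Longrightarrow> v \<le> w \<Longrightarrow> app T v - app T (w - v) \<le> z"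
    using least that by (simp add: eq)
qed

lemma abs_regop_least:
  fixes T :: "('a::banach_lattice, 'b::dedekind_complete_banach_lattice) regop"
  assumes "T \<le> N" "- T \<le> N"
  shows "\<bar>T\<bar> \<le> N"
  unfolding less_eq_regop_iff
  by (intro allI impI app_abs_regop_least app_swing_le[OF assms])

lemma abs_app_le_dominating:
  fixes T N :: "('a::generated_ordered_vector, 'b::banach_lattice) regop"
  assumes "T \<le> N" "- T \<le> N" "0 \<le> w"
  shows "\<bar>app T w\<bar> \<le> app N w"
  using assms by (simp add: less_eq_regop_iff uminus_regop.rep_eq abs_le_iff)

lemma abs_regop_nonneg:
  fixes T :: "('a::banach_lattice, 'b::dedekind_complete_banach_lattice) regop"
  shows "0 \<le> \<bar>T\<bar>"
  using order_trans[OF abs_ge_zero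
      abs_app_le_dominating[OF abs_regop_ge_self[of T] abs_regop_ge_minus_self[of T]]]
  by (simp add: less_eq_regop_iff zero_regop.rep_eq)

lemma abs_app_le:
  fixes T :: "('a::banach_lattice, 'b::dedekind_complete_banach_lattice) regop"
  shows "\<bar>app T x\<bar> \<le> app \<bar>T\<bar> \<bar>x\<bar>"
proof -
  have "\<bar>app T (pprt x)\<bar> + \<bar>app T (- nprt x)\<bar> \<le> app \<bar>T\<bar> (pprt x) + app \<bar>T\<bar> (- nprt x)"
    by (intro add_mono abs_app_le_dominating abs_regop_ge_self abs_regop_ge_minus_self) simp_all
  also have "\<dots> = app \<bar>T\<bar> \<bar>x\<bar>"
    by (simp add: abs_prts linear_add[OF linear_app, symmetric])
  finally have "\<bar>app T (pprt x)\<bar> + \<bar>app T (- nprt x)\<bar> \<le> app \<bar>T\<bar> \<bar>x\<bar>" .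
  moreover have "app T x = app T (pprt x) - app T (- nprt x)"
    by (simp add: linear_diff[OF linear_app, symmetric] prts[symmetric])
  ultimately show ?thesis
    using abs_triangle_ineq4 order_trans by metis
qed

lemma abs_regop_of_nonneg: "0 \<le> S \<Longrightarrow> \<bar>S\<bar> = S"
  for S :: "('a::generated_ordered_vector, 'b::generated_ordered_vector) regop"
  by (rule abs_regop_eqI) (auto intro: order_trans[of _ 0])


section \<open>The modulus of a two-sided multiplication operator\<close>

lemma app_two_sided_mult: "app (app (two_sided_mult A B) T) w = app A (app T (app B w))"
  by (simp add: two_sided_mult.rep_eq compose_regop.rep_eq)

text \<open>
  Order continuity applies to the downward directed set of all \<open>s - g\<close>, whose infimum is \<open>0\<close>.
\<close>

lemma order_continuous_approximation:
  fixes G :: "'a::order_continuous_banach_lattice set"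
  assumes ne: "G \<noteq> {}"
    and sup: "\<And>g h. g \<in> G \<Longrightarrow> h \<in> G \<Longrightarrow> sup g h \<in> G"
    and upper: "\<And>g. g \<in> G \<Longrightarrow> g \<le> s"
    and least: "\<And>u. (\<And>g. g \<in> G \<Longrightarrow> g \<le> u) \<Longrightarrow> s \<le> u"
  obtains f :: "nat \<Rightarrow> 'a" where "\<And>n. f n \<in> G" "f \<longlonglongrightarrow> s"
proof -
  have ex: "\<exists>g\<in>G. norm (g - s) < e" if "0 < e" for e :: real
  proof -
    have "\<exists>x\<in>(\<lambda>g. s - g) ` G. \<forall>y\<in>(\<lambda>g. s - g) ` G. y \<le> x \<longrightarrow> norm y < e"
    proof (rule order_continuous_norm[OF _ _ _ _ that])
      show "\<exists>z\<in>(\<lambda>g. s - g) ` G. z \<le> x \<and> z \<le> y"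
        if xy: "x \<in> (\<lambda>g. s - g) ` G" "y \<in> (\<lambda>g. s - g) ` G" for x y
      proof -
        obtain g h where gh: "x = s - g" "g \<in> G" "y = s - h" "h \<in> G"
          using xy by blast
        show ?thesis
          by (rule bexI[OF _ imageI[OF sup[OF gh(2,4)]]])
            (simp add: gh(1,3) diff_left_mono del: diff_sup_eq_inf)
      qed
      show "b \<le> 0" if "\<And>x. x \<in> (\<lambda>g. s - g) ` G \<Longrightarrow> b \<le> x" for b
      proof -
        have "g \<le> s - b" if "g \<in> G" for g
          using \<open>\<And>x. x \<in> (\<lambda>g. s - g) ` G \<Longrightarrow> b \<le> x\<close>[of "s - g"] that
          by (simp add: le_diff_eq add.commute)
        then have "s \<le> s - b"
          by (rule least)
        then show ?thesis
          by simp
      qed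
    qed (use ne upper in auto)
    then obtain x where "x \<in> (\<lambda>g. s - g) ` G" "norm x < e"
      by blast
    then show ?thesis
      by (auto simp: norm_minus_commute)
  qed
  have "\<exists>g. g \<in> G \<and> norm (g - s) < inverse (real (Suc n))" for n
    using ex[of "inverse (real (Suc n))"] by auto
  then obtain f where f: "\<And>n. f n \<in> G" "\<And>n. norm (f n - s) < inverse (real (Suc n))"
    by metis
  have "(\<lambda>n. f n - s) \<longlonglongrightarrow> 0"
    by (rule Lim_null_comparison[OF _ LIMSEQ_inverse_real_of_nat])
      (auto intro!: always_eventually less_imp_le f(2) simp del: of_nat_Suc)
  then have "f \<longlonglongrightarrow> s"
    by (rule LIM_zero_cancel)
  then show thesis
    using f(1) that by blast
qed

text \<open>
  The minimality half of \<open>\<bar>M\<^bsub>A,B\<^esub>\<bar> = M\<^bsub>\<bar>A\<bar>,\<bar>B\<bar>\<^esub>\<close>. Membership in the set \<open>G\<close> quantifies over all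
  positive \<open>S\<close> rather than over the given \<open>T\<close> alone, because closure under suprema needs the
  inequality for \<open>S Q\<close> and \<open>S Q'\<close> in place of \<open>S\<close>.
\<close>

lemma two_sided_mult_abs_least:
  fixes A :: "('y::dedekind_complete_banach_lattice, 'z::dedekind_complete_banach_lattice) regop"
    and B :: "('w::banach_lattice, 'x::order_continuous_banach_lattice) regop"
    and N :: "(('x, 'y) regop, ('w, 'z) regop) regop"
  assumes N: "two_sided_mult A B \<le> N" "- two_sided_mult A B \<le> N"
  shows "two_sided_mult \<bar>A\<bar> \<bar>B\<bar> \<le> N"
proof -
  have N_add: "app (app N (S + S')) w = app (app N S) w + app (app N S') w" for S S' w
    by (simp add: linear_add[OF linear_app] plus_regop.rep_eq)
  have N_app: "app (two_sided_mult A B) S \<le> app N S" "- app (two_sided_mult A B) S \<le> app N S"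
    if "0 \<le> S" for S
    using N that by (simp_all add: less_eq_regop_iff[of "two_sided_mult A B"]
        less_eq_regop_iff[of "- two_sided_mult A B"] uminus_regop.rep_eq)
  have N_pos: "0 \<le> app (app N S) w" if "0 \<le> S" "0 \<le> w" for S w
    using order_trans[OF abs_ge_zero abs_app_le_dominating[OF N_app[OF that(1)] that(2)]] .
  have comp_pos: "0 \<le> S \<circ>\<^sub>r T" if "0 \<le> S" "0 \<le> T"
    for S :: "('e::generated_ordered_vector, 'f::generated_ordered_vector) regop"
      and T :: "('d::generated_ordered_vector, 'e) regop"
    using that by (simp add: less_eq_regop_iff zero_regop.rep_eq compose_regop.rep_eq)
  have bound: "app \<bar>A\<bar> (app T (app \<bar>B\<bar> w)) \<le> app (app N T) w"
    if T: "0 \<le> T" and w: "0 \<le> w" for T w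
  proof -
    define G where "G = {g. g \<le> app \<bar>B\<bar> w \<and> (\<forall>S\<ge>0. app \<bar>A\<bar> (app S g) \<le> app (app N S) w)}"
    have swing: "app B v - app B (w - v) \<in> G" if v: "0 \<le> v" "v \<le> w" for v
    proof -
      define g where "g = app B v - app B (w - v)"
      have N_g: "app A (app S g) \<le> app (app N S) w" "- app A (app S g) \<le> app (app N S) w"
        if "0 \<le> S" for S
      proof -
        note le = N_app[OF that]
        show "app A (app S g) \<le> app (app N S) w"
          using app_swing_le[OF le v] by (simp add: app_two_sided_mult g_def linear_diff[OF linear_app])
        show "- app A (app S g) \<le> app (app N S) w"
          using app_swing_le[OF le(2) _ v] le(1)
          by (simp add: app_two_sided_mult g_def linear_diff[OF linear_app] uminus_regop.rep_eq
              linear_add[OF linear_app] algebra_simps)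
      qed
      \<comment> \<open>\<open>Q\<close> cuts \<open>g\<close> down to \<open>g\<^sup>+\<close>, so that \<open>S g\<close> may be replaced by the positive \<open>y = S Q g\<close>.\<close>
      obtain Q Q' :: "('x, 'x) regop" where Q: "0 \<le> Q" "0 \<le> Q'" "\<And>x. app Q x + app Q' x = x"
        "app Q g = pprt g"
        using splitting_of_identity[of "pprt g" g] by auto
      have "app \<bar>A\<bar> (app S g) \<le> app (app N S) w" if S: "0 \<le> S" for S
      proof -
        define y where "y = app S (pprt g)"
        have y: "0 \<le> y"
          using S by (simp add: y_def less_eq_regop_iff zero_regop.rep_eq)
        have "app \<bar>A\<bar> y \<le> app (app N S) w"
        proof (rule app_abs_regop_least[OF y])
          fix u
          assume u: "0 \<le> u" "u \<le> y"
          \<comment> \<open>The signs of \<open>A\<close> on \<open>u\<close> and on \<open>y - u\<close> are absorbed by two different pieces of \<open>S\<close>.\<close>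
          obtain P P' :: "('y, 'y) regop" where P: "0 \<le> P" "0 \<le> P'"
            "\<And>x. app P x + app P' x = x" "app P y = u"
            using splitting_of_identity[of u y] u y by auto
          have "app P' y = y - u"
            using P(3)[of y] by (simp add: P(4) eq_diff_eq add.commute)
          have S_eq: "S = ((P \<circ>\<^sub>r S \<circ>\<^sub>r Q) + (P' \<circ>\<^sub>r S \<circ>\<^sub>r Q)) + (S \<circ>\<^sub>r Q')"
            by (simp add: app_inject[symmetric] fun_eq_iff plus_regop.rep_eq compose_regop.rep_eq
                P(3) linear_add[OF linear_app, symmetric] Q(3))
          have "app A u - app A (y - u)
              = app A (app (P \<circ>\<^sub>r S \<circ>\<^sub>r Q) g) + - app A (app (P' \<circ>\<^sub>r S \<circ>\<^sub>r Q) g)"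
            using P(4) \<open>app P' y = y - u\<close> by (simp add: compose_regop.rep_eq Q(4) y_def)
          also have "\<dots> \<le> app (app N (P \<circ>\<^sub>r S \<circ>\<^sub>r Q)) w + app (app N (P' \<circ>\<^sub>r S \<circ>\<^sub>r Q)) w"
            by (intro add_mono N_g comp_pos P S Q)
          also have "\<dots> \<le> app (app N (P \<circ>\<^sub>r S \<circ>\<^sub>r Q)) w + app (app N (P' \<circ>\<^sub>r S \<circ>\<^sub>r Q)) w
              + app (app N (S \<circ>\<^sub>r Q')) w"
            using N_pos[OF comp_pos[OF S Q(2)] w] by simp
          also have "\<dots> = app (app N S) w"
            by (subst (4) S_eq) (simp only: N_add)
          finally show "app A u - app A (y - u) \<le> app (app N S) w" .
        qed
        moreover have "app S g \<le> y"
          unfolding y_def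
          by (rule positive_operator_mono[OF positive_operator_app[OF S]]) (simp add: pprt_def)
        then have "app \<bar>A\<bar> (app S g) \<le> app \<bar>A\<bar> y"
          by (rule positive_operator_mono[OF positive_operator_app[OF abs_regop_nonneg]])
        ultimately show ?thesis
          by (rule order_trans[rotated])
      qed
      moreover have "g \<le> app \<bar>B\<bar> w"
        unfolding g_def by (rule app_swing_le[OF abs_regop_ge_self abs_regop_ge_minus_self v])
      ultimately show ?thesis
        by (simp add: G_def flip: g_def)
    qed
    have sup: "sup g h \<in> G" if gh: "g \<in> G" "h \<in> G" for g h
    proof -
      \<comment> \<open>\<open>Q\<close> takes \<open>g - h\<close> to its positive part; thus \<open>sup g h = h + Q (g - h) = Q g + Q' h\<close>.\<close>
      obtain Q Q' :: "('x, 'x) regop" where Q: "0 \<le> Q" "0 \<le> Q'" "\<And>x. app Q x + app Q' x = x"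
        "app Q (g - h) = pprt (g - h)"
        using splitting_of_identity[of "pprt (g - h)" "g - h"] by auto
      have "sup g h = pprt (g - h) + h"
        by (simp add: pprt_def add_sup_distrib_right)
      also have "\<dots> = app Q (g - h) + (app Q h + app Q' h)"
        by (simp only: Q(3,4))
      also have "\<dots> = app Q g + app Q' h"
        by (simp add: linear_diff[OF linear_app])
      finally have eq: "sup g h = app Q g + app Q' h" .
      have "app \<bar>A\<bar> (app S (sup g h)) \<le> app (app N S) w" if S: "0 \<le> S" for S
      proof -
        have "app \<bar>A\<bar> (app S (sup g h))
            = app \<bar>A\<bar> (app (S \<circ>\<^sub>r Q) g) + app \<bar>A\<bar> (app (S \<circ>\<^sub>r Q') h)"
          by (simp add: eq linear_add[OF linear_app] compose_regop.rep_eq)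
        also have "\<dots> \<le> app (app N (S \<circ>\<^sub>r Q)) w + app (app N (S \<circ>\<^sub>r Q')) w"
          using gh comp_pos[OF S Q(1)] comp_pos[OF S Q(2)] by (intro add_mono) (auto simp: G_def)
        also have "\<dots> = app (app N ((S \<circ>\<^sub>r Q) + (S \<circ>\<^sub>r Q'))) w"
          by (simp only: N_add)
        also have "(S \<circ>\<^sub>r Q) + (S \<circ>\<^sub>r Q') = S"
          by (simp add: app_inject[symmetric] fun_eq_iff plus_regop.rep_eq compose_regop.rep_eq
              linear_add[OF linear_app, symmetric] Q(3))
        finally show ?thesis .
      qed
      then show ?thesis
        using gh by (simp add: G_def)
    qed
    obtain f where f: "\<And>n. f n \<in> G" "f \<longlonglongrightarrow> app \<bar>B\<bar> w"
    proof (rule order_continuous_approximation[of G "app \<bar>B\<bar> w"])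
      show "G \<noteq> {}"
        using swing[OF order_refl w] by blast
      show "app \<bar>B\<bar> w \<le> u" if "\<And>g. g \<in> G \<Longrightarrow> g \<le> u" for u
        by (rule app_abs_regop_least[OF w]) (rule that[OF swing])
    qed (use sup in \<open>auto simp: G_def\<close>)
    have "bounded_linear (\<lambda>x. app \<bar>A\<bar> (app T x))"
      by (rule bounded_linear_positive_operator[OF positive_operator_compose
            [OF positive_operator_app[OF abs_regop_nonneg] positive_operator_app[OF T]]])
    then have "(\<lambda>n. app \<bar>A\<bar> (app T (f n))) \<longlonglongrightarrow> app \<bar>A\<bar> (app T (app \<bar>B\<bar> w))"
      using f(2) by (rule bounded_linear.tendsto)
    moreover have "app \<bar>A\<bar> (app T (f n)) \<le> app (app N T) w" for n
      using f(1)[of n] T by (simp add: G_def)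
    ultimately show ?thesis
      by (rule LIMSEQ_le_banach_lattice[OF _ tendsto_const])
  qed
  show ?thesis
    using bound by (simp add: less_eq_regop_iff app_two_sided_mult)
qed

lemma abs_two_sided_mult:
  fixes A :: "('y::dedekind_complete_banach_lattice, 'z::dedekind_complete_banach_lattice) regop"
    and B :: "('w::banach_lattice, 'x::order_continuous_banach_lattice) regop"
  shows "\<bar>two_sided_mult A B :: (('x, 'y) regop, ('w, 'z) regop) regop\<bar>
    = two_sided_mult \<bar>A\<bar> \<bar>B\<bar>"
proof (rule abs_regop_eqI)
  have *: "\<bar>app A (app T (app B w))\<bar> \<le> app \<bar>A\<bar> (app T (app \<bar>B\<bar> w))"
    if T: "0 \<le> T" and w: "0 \<le> w" for T :: "('x, 'y) regop" and w
  proof -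
    have "\<bar>app A (app T (app B w))\<bar> \<le> app \<bar>A\<bar> \<bar>app T (app B w)\<bar>"
      by (rule abs_app_le)
    also have "\<dots> \<le> app \<bar>A\<bar> (app T \<bar>app B w\<bar>)"
      by (intro positive_operator_mono[OF positive_operator_app[OF abs_regop_nonneg]]
          abs_positive_operator_le positive_operator_app T)
    also have "\<dots> \<le> app \<bar>A\<bar> (app T (app \<bar>B\<bar> \<bar>w\<bar>))"
      by (intro positive_operator_mono[OF positive_operator_app[OF abs_regop_nonneg]]
          positive_operator_mono[OF positive_operator_app[OF T]] abs_app_le)
    finally show ?thesis
      using w by simp
  qed
  show "two_sided_mult A B \<le> (two_sided_mult \<bar>A\<bar> \<bar>B\<bar> :: (('x, 'y) regop, ('w, 'z) regop) regop)"
    "- two_sided_mult A B \<le> (two_sided_mult \<bar>A\<bar> \<bar>B\<bar> :: (('x, 'y) regop, ('w, 'z) regop) regop)"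
    using * by (auto simp: less_eq_regop_iff uminus_regop.rep_eq app_two_sided_mult abs_le_iff)
qed (rule two_sided_mult_abs_least)


section \<open>Regular norms\<close>

lemma regular_norm_eq: "regular_norm S = onorm (app \<bar>S\<bar>)"
  by (simp add: regular_norm_def regular_norm_wrt_def operator_norm_eq_onorm)

lemma bounded_linear_app_abs:
  fixes S :: "('a::banach_lattice, 'b::dedekind_complete_banach_lattice) regop"
  shows "bounded_linear (app \<bar>S\<bar>)"
  by (intro bounded_linear_positive_operator positive_operator_app abs_regop_nonneg)

lemma regular_norm_nonneg:
  fixes S :: "('a::banach_lattice, 'b::dedekind_complete_banach_lattice) regop"
  shows "0 \<le> regular_norm S"
  unfolding regular_norm_eq by (rule onorm_pos_le[OF bounded_linear_app_abs])

lemma onorm_positive_mono: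
  fixes P Q :: "('a::banach_lattice, 'b::banach_lattice) regop"
  assumes P: "0 \<le> P" and PQ: "P \<le> Q"
  shows "onorm (app P) \<le> onorm (app Q)"
proof (rule onorm_bound)
  have bl: "bounded_linear (app Q)"
    by (intro bounded_linear_positive_operator positive_operator_app order_trans[OF P PQ])
  then show "0 \<le> onorm (app Q)"
    by (rule onorm_pos_le)
  fix x
  have "\<bar>app P x\<bar> \<le> app P \<bar>x\<bar>"
    by (rule abs_positive_operator_le[OF positive_operator_app[OF P]])
  also have "\<dots> \<le> app Q \<bar>x\<bar>"
    using PQ by (simp add: less_eq_regop_iff)
  also have "\<dots> \<le> \<bar>app Q \<bar>x\<bar>\<bar>"
    by (rule abs_ge_self)
  finally have "norm (app P x) \<le> norm (app Q \<bar>x\<bar>)"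
    by (rule norm_lattice)
  also have "\<dots> \<le> onorm (app Q) * norm \<bar>x\<bar>"
    by (rule onorm[OF bl])
  finally show "norm (app P x) \<le> onorm (app Q) * norm x"
    by (simp add: norm_abs_banach_lattice)
qed

lemma regular_norm_two_sided_le:
  fixes A :: "('y::dedekind_complete_banach_lattice, 'z::dedekind_complete_banach_lattice) regop"
    and B :: "('w::banach_lattice, 'x::dedekind_complete_banach_lattice) regop"
    and T :: "('x, 'y) regop"
  shows "regular_norm (app (two_sided_mult \<bar>A\<bar> \<bar>B\<bar>) T)
    \<le> (regular_norm A * regular_norm B) * regular_norm T"
proof -
  let ?M = "two_sided_mult \<bar>A\<bar> \<bar>B\<bar> :: (('x, 'y) regop, ('w, 'z) regop) regop"
  have M: "positive_operator (app ?M)"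
    using positive_operator_two_sided[OF positive_operator_app positive_operator_app,
        OF abs_regop_nonneg abs_regop_nonneg, of A B]
    by (simp add: two_sided_mult.rep_eq)
  have "app ?M T \<le> app ?M \<bar>T\<bar>"
    by (rule positive_operator_mono[OF M abs_regop_ge_self])
  moreover have "- app ?M T \<le> app ?M \<bar>T\<bar>"
    using positive_operator_mono[OF M abs_regop_ge_minus_self, of T]
    by (simp add: linear_neg[OF linear_app])
  ultimately have "\<bar>app ?M T\<bar> \<le> app ?M \<bar>T\<bar>"
    by (rule abs_regop_least)
  then have "regular_norm (app ?M T) \<le> onorm (app (app ?M \<bar>T\<bar>))"
    unfolding regular_norm_eq by (rule onorm_positive_mono[OF abs_regop_nonneg])
  also have "app (app ?M \<bar>T\<bar>) = app \<bar>A\<bar> \<circ> (app \<bar>T\<bar> \<circ> app \<bar>B\<bar>)"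
    by (simp add: fun_eq_iff app_two_sided_mult)
  also have "onorm \<dots> \<le> onorm (app \<bar>A\<bar>) * onorm (app \<bar>T\<bar> \<circ> app \<bar>B\<bar>)"
    using bounded_linear_compose[OF bounded_linear_app_abs bounded_linear_app_abs]
    by (intro onorm_compose bounded_linear_app_abs) (simp add: o_def)
  also have "\<dots> \<le> onorm (app \<bar>A\<bar>) * (onorm (app \<bar>T\<bar>) * onorm (app \<bar>B\<bar>))"
    by (intro mult_left_mono onorm_compose bounded_linear_app_abs onorm_pos_le)
  finally show ?thesis
    by (simp add: regular_norm_eq mult_ac)
qed

text \<open>
  The witness is the rank one operator \<open>x \<mapsto> f x y\<close>, with \<open>f\<close> a positive functional of norm at most
  \<open>1\<close> that attains the norm of \<open>\<bar>B\<bar> w\<close>. Its image \<open>\<bar>A\<bar> T \<bar>B\<bar>\<close> maps \<open>w\<close> to \<open>\<parallel>\<bar>B\<bar> w\<parallel> \<bar>A\<bar> y\<close>.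
\<close>

lemma norm_product_le_regular_norm_two_sided:
  fixes A :: "('y::dedekind_complete_banach_lattice, 'z::dedekind_complete_banach_lattice) regop"
    and B :: "('w::banach_lattice, 'x::dedekind_complete_banach_lattice) regop"
  assumes y: "0 \<le> y" and w: "0 \<le> w"
  obtains T :: "('x, 'y) regop" where "regular_norm T \<le> norm y"
    "norm (app \<bar>A\<bar> y) * norm (app \<bar>B\<bar> w)
      \<le> regular_norm (app (two_sided_mult \<bar>A\<bar> \<bar>B\<bar>) T) * norm w"
proof -
  have "0 \<le> app \<bar>B\<bar> w"
    using positive_operator_app[OF abs_regop_nonneg, of B] w by (simp add: positive_operator_def)
  then obtain f where f: "linear f" "\<And>x. 0 \<le> x \<Longrightarrow> 0 \<le> f x" "\<And>x. \<bar>f x\<bar> \<le> norm x"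
    "f (app \<bar>B\<bar> w) = norm (app \<bar>B\<bar> w)"
    by (rule positive_norming_functional) blast
  have "positive_operator (\<lambda>x. f x *\<^sub>R y)"
    unfolding positive_operator_def
  proof
    show "linear (\<lambda>x. f x *\<^sub>R y)"
      by (rule linearI) (simp_all add: linear_add[OF f(1)] linear_scale[OF f(1)] scaleR_add_left)
  qed (use f(2) y in \<open>auto intro: scaleR_nonneg_nonneg\<close>)
  then obtain T :: "('x, 'y) regop" where T: "0 \<le> T" "app T = (\<lambda>x. f x *\<^sub>R y)"
    by (rule positive_operator_regopE)
  let ?S = "app (two_sided_mult \<bar>A\<bar> \<bar>B\<bar>) T"
  have "0 \<le> ?S"
    using positive_operator_app[OF abs_regop_nonneg, of A] positive_operator_app[OF T(1)]
      positive_operator_app[OF abs_regop_nonneg, of B]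
    by (simp add: less_eq_regop_iff[of 0 ?S] zero_regop.rep_eq app_two_sided_mult positive_operator_def)
  then have S: "\<bar>?S\<bar> = ?S"
    by (rule abs_regop_of_nonneg)
  show thesis
  proof
    show "regular_norm T \<le> norm y"
      unfolding regular_norm_eq abs_regop_of_nonneg[OF T(1)] T(2)
      using f(3) by (intro onorm_bound) (auto intro: mult_left_mono simp: mult.commute[of _ "norm y"])
    have "norm (app ?S w) \<le> onorm (app ?S) * norm w"
      using onorm[OF bounded_linear_app_abs[of ?S], of w] by (simp add: S)
    moreover have "app ?S w = norm (app \<bar>B\<bar> w) *\<^sub>R app \<bar>A\<bar> y"
      by (simp add: app_two_sided_mult T(2) f(4) linear_scale[OF linear_app])
    ultimately show "norm (app \<bar>A\<bar> y) * norm (app \<bar>B\<bar> w) \<le> regular_norm ?S * norm w"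
      by (simp add: regular_norm_eq S mult.commute)
  qed
qed

theorem corollary2p4:
  fixes A :: "('y::order_continuous_banach_lattice, 'z::dedekind_complete_banach_lattice) regop"
    and B :: "('w::banach_lattice, 'x::order_continuous_banach_lattice) regop"
  shows "regular_norm_wrt regular_norm regular_norm
      (two_sided_mult A B :: (('x, 'y) regop, ('w, 'z) regop) regop)
    = regular_norm A * regular_norm B"
proof -
  let ?M = "two_sided_mult \<bar>A\<bar> \<bar>B\<bar> :: (('x, 'y) regop, ('w, 'z) regop) regop"
  define s where "s = (SUP T. regular_norm (app ?M T) / regular_norm T)"
  have quotient_le: "regular_norm (app ?M T) / regular_norm T \<le> regular_norm A * regular_norm B" for T
    using regular_norm_two_sided_le[of A B T] regular_norm_nonneg[of T]
      regular_norm_nonneg[of A] regular_norm_nonneg[of B]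
    by (cases "regular_norm T = 0") (auto simp: pos_divide_le_eq)
  \<comment> \<open>If \<open>\<parallel>T\<parallel>\<^sub>r = 0\<close>, the quotient in \<open>s\<close> is \<open>0\<close> by convention and says nothing about the image.\<close>
  have M_le: "regular_norm (app ?M T) \<le> s * regular_norm T" for T
  proof (cases "regular_norm T = 0")
    case True
    then show ?thesis
      using regular_norm_two_sided_le[of A B T] by simp
  next
    case False
    have "regular_norm (app ?M T) / regular_norm T \<le> s"
      unfolding s_def using quotient_le by (intro cSUP_upper bdd_aboveI2) auto
    then show ?thesis
      using False regular_norm_nonneg[of T] by (simp add: pos_divide_le_eq)
  qed
  have "regular_norm (app ?M 0) / regular_norm (0 :: ('x, 'y) regop) \<le> s"
    unfolding s_def using quotient_le by (intro cSUP_upper bdd_aboveI2) auto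
  then have s0: "0 \<le> s"
    using divide_nonneg_nonneg[OF regular_norm_nonneg regular_norm_nonneg] order_trans by blast
  have prod: "norm (app \<bar>A\<bar> y) * norm (app \<bar>B\<bar> w) \<le> s * norm y * norm w" for y w
  proof -
    obtain T :: "('x, 'y) regop" where T: "regular_norm T \<le> norm \<bar>y\<bar>"
      "norm (app \<bar>A\<bar> \<bar>y\<bar>) * norm (app \<bar>B\<bar> \<bar>w\<bar>) \<le> regular_norm (app ?M T) * norm \<bar>w\<bar>"
      using norm_product_le_regular_norm_two_sided[of "\<bar>y\<bar>" "\<bar>w\<bar>" A B] by auto
    have norm_le: "norm (app \<bar>S\<bar> x) \<le> norm (app \<bar>S\<bar> \<bar>x\<bar>)"
      for S :: "('e::banach_lattice, 'f::dedekind_complete_banach_lattice) regop" and x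
      by (rule norm_lattice) (rule order_trans[OF abs_positive_operator_le abs_ge_self],
          rule positive_operator_app[OF abs_regop_nonneg])
    have "norm (app \<bar>A\<bar> y) * norm (app \<bar>B\<bar> w) \<le> norm (app \<bar>A\<bar> \<bar>y\<bar>) * norm (app \<bar>B\<bar> \<bar>w\<bar>)"
      by (intro mult_mono norm_le norm_ge_zero)
    also have "\<dots> \<le> regular_norm (app ?M T) * norm \<bar>w\<bar>"
      by (rule T(2))
    also have "\<dots> \<le> (s * norm \<bar>y\<bar>) * norm \<bar>w\<bar>"
      using M_le[of T] mult_left_mono[OF T(1) s0] by (intro mult_right_mono) auto
    finally show ?thesis
      by (simp add: norm_abs_banach_lattice)
  qed
  have "onorm (app \<bar>A\<bar>) * norm (app \<bar>B\<bar> w) \<le> s * norm w" for w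
  proof -
    have "onorm (\<lambda>y. norm (app \<bar>B\<bar> w) *\<^sub>R app \<bar>A\<bar> y) \<le> s * norm w"
      using prod[of _ w] s0 by (intro onorm_bound) (auto simp: mult_ac)
    then show ?thesis
      by (simp add: onorm_scaleR[OF bounded_linear_app_abs] mult.commute)
  qed
  then have "onorm (\<lambda>w. onorm (app \<bar>A\<bar>) *\<^sub>R app \<bar>B\<bar> w) \<le> s"
    using s0 onorm_pos_le[OF bounded_linear_app_abs[of A]] by (intro onorm_bound) auto
  then have "regular_norm A * regular_norm B \<le> s"
    using onorm_pos_le[OF bounded_linear_app_abs[of A]]
    by (simp add: onorm_scaleR[OF bounded_linear_app_abs] regular_norm_eq)
  moreover have "s \<le> regular_norm A * regular_norm B"
    unfolding s_def using quotient_le by (intro cSUP_least) auto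
  ultimately show ?thesis
    by (simp add: regular_norm_wrt_def operator_norm_def abs_two_sided_mult s_def)
qed

end
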